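(* Let $\ell>0$ and $\alpha=1/\sqrt2$. There exist constants $C_1,C_2>0$ and $0<\eta<1$ such that the following holds for every $N\ge 1$ and every $N$-point quadrature rule $Q_N(f)=\sum_{n=1}^Nw_nf(x_n)$ (the constants being independent of $N$ and $Q_N$). Suppose that the nodes $x_1,\ldots,x_N\in\mathbb{R}$ and weights $w_1,\ldots,w_N\in\mathbb{R}$ of $Q_N$ satisfy 1. $\sum_{n=1}^N|w_n|\le W_N$ for some $W_N\ge0$; 2. $Q_N(\varphi_n^\alpha)=\mu(\varphi_n^\alpha)$ for each $n=0,\ldots,M_N-1$ for some integer $M_N\ge1$; 3. $\sup_{1\le n\le N}|x_n|\le 2\sqrt{M_N}/\beta$. Then $$e(Q_N)\le(1+C_1W_N)\,C_2\,\eta^{M_N}.$$ Explicitly, one may take $C_1=K\sqrt\beta$, $C_2=\sqrt\tau/(1-\sqrt\lambda)$ and $\eta=\sqrt\lambda\,e^{1/\beta^2}$, where $K\le1.087$ is an absolute constant.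
   Context: $\mu$ is the standard Gaussian measure on $\mathbb{R}$ and $\mu(f)=\int f\,\mathrm{d}\mu$. $k(x,y)=\exp(-(x-y)^2/(2\ell^2))$ is the Gaussian kernel with length-scale $\ell>0$, and $\mathcal{H}$ is its reproducing kernel Hilbert space of functions on $\mathbb{R}$. The worst-case error of a quadrature rule $Q$ is $e(Q)=\sup_{\|f\|_{\mathcal{H}}\le1}|\mu(f)-Q(f)|$. $\mathrm{H}_n(x)=(-1)^ne^{x^2/2}\frac{\mathrm{d}^n}{\mathrm{d}x^n}e^{-x^2/2}$ are the probabilists' Hermite polynomials. With $\alpha=1/\sqrt2$, set $$\epsilon=\frac1{\sqrt2\,\ell},\qquad \beta=\Big(1+\Big(\frac{2\epsilon}{\alpha}\Big)^2\Big)^{1/4}=(1+8\epsilon^2)^{1/4},\qquad \delta^2=\frac{\alpha^2}{2}(\beta^2-1)=\frac14(\beta^2-1),$$ $$\tau=\sqrt{\frac{1/2}{1/2+\delta^2+\epsilon^2}},\qquad \lambda=\frac{\epsilon^2}{1/2+\delta^2+\epsilon^2},\qquad \varphi_n^\alpha(x)=\sqrt{\frac{\beta}{n!}}\,e^{-\delta^2x^2}\mathrm{H}_n(\sqrt2\,\alpha\beta x)\quad(n\ge0).$$ The $\varphi_n^\alpha$ are the $L^2(\mu)$-orthonormal Mercer eigenfunctions of $k$, with eigenvalues $\tau\lambda^n$. *)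

theory Defs
  imports "HOL-Probability.Probability"
begin

text \<open>
  The reproducing kernel Hilbert space of a kernel \<open>k\<close> on \<open>'a\<close>: a real Hilbert space \<open>H\<close> of
  functions on \<open>'a\<close> (pointwise operations, inner product \<open>ip\<close>, complete in the induced norm)
  that contains every \<open>k(\<cdot>, x)\<close> and has the reproducing property.  By the Moore--Aronszajn theorem,
  for a positive semi-definite \<open>k\<close> there is exactly one such \<open>H\<close>, and \<open>ip\<close> is unique on \<open>H\<close>
  (values of \<open>ip\<close> off \<open>H\<close> are unconstrained and never used).
\<close>

definition rkhs_norm :: "(('a \<Rightarrow> real) \<Rightarrow> ('a \<Rightarrow> real) \<Rightarrow> real) \<Rightarrow> ('a \<Rightarrow> real) \<Rightarrow> real" where
  "rkhs_norm ip f = sqrt (ip f f)"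

locale rkhs =
  fixes k :: "'a \<Rightarrow> 'a \<Rightarrow> real"
    and H :: "('a \<Rightarrow> real) set"
    and ip :: "('a \<Rightarrow> real) \<Rightarrow> ('a \<Rightarrow> real) \<Rightarrow> real"
  assumes zero_mem: "(\<lambda>x. 0) \<in> H"
    and add_mem: "\<And>f g. f \<in> H \<Longrightarrow> g \<in> H \<Longrightarrow> (\<lambda>x. f x + g x) \<in> H"
    and scale_mem: "\<And>c f. f \<in> H \<Longrightarrow> (\<lambda>x. c * f x) \<in> H"
    and ip_commute: "\<And>f g. f \<in> H \<Longrightarrow> g \<in> H \<Longrightarrow> ip f g = ip g f"
    and ip_add_left: "\<And>f g h. f \<in> H \<Longrightarrow> g \<in> H \<Longrightarrow> h \<in> H \<Longrightarrow>
                        ip (\<lambda>x. f x + g x) h = ip f h + ip g h"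
    and ip_scale_left: "\<And>c f g. f \<in> H \<Longrightarrow> g \<in> H \<Longrightarrow> ip (\<lambda>x. c * f x) g = c * ip f g"
    and ip_nonneg: "\<And>f. f \<in> H \<Longrightarrow> 0 \<le> ip f f"
    and ip_definite: "\<And>f. f \<in> H \<Longrightarrow> ip f f = 0 \<Longrightarrow> f = (\<lambda>x. 0)"
    and complete: "\<And>u :: nat \<Rightarrow> 'a \<Rightarrow> real. (\<And>n. u n \<in> H) \<Longrightarrow>
          (\<forall>e>0. \<exists>n0. \<forall>m\<ge>n0. \<forall>n\<ge>n0. rkhs_norm ip (\<lambda>x. u m x - u n x) < e) \<Longrightarrow>
          \<exists>f\<in>H. (\<lambda>n. rkhs_norm ip (\<lambda>x. u n x - f x)) \<longlonglongrightarrow> 0"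
    and kernel_mem: "\<And>x. (\<lambda>y. k y x) \<in> H"
    and reproducing: "\<And>f x. f \<in> H \<Longrightarrow> ip f (\<lambda>y. k y x) = f x"

definition gauss_kernel :: "real \<Rightarrow> real \<Rightarrow> real \<Rightarrow> real" where
  "gauss_kernel l x y = exp (- (x - y)\<^sup>2 / (2 * l\<^sup>2))"

definition gauss_mean :: "(real \<Rightarrow> real) \<Rightarrow> real" where
  "gauss_mean f = integral\<^sup>L (density lborel std_normal_density) f"

definition quadrature :: "nat \<Rightarrow> (nat \<Rightarrow> real) \<Rightarrow> (nat \<Rightarrow> real) \<Rightarrow> (real \<Rightarrow> real) \<Rightarrow> real" where
  "quadrature N w x f = (\<Sum>n=1..N. w n * f (x n))"

text \<open>The supremum is taken in \<open>ereal\<close>, so that a bound on it always bounds every member.\<close>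

definition worst_case_error ::
  "(real \<Rightarrow> real) set \<Rightarrow> ((real \<Rightarrow> real) \<Rightarrow> (real \<Rightarrow> real) \<Rightarrow> real) \<Rightarrow>
   ((real \<Rightarrow> real) \<Rightarrow> real) \<Rightarrow> ereal" where
  "worst_case_error H ip Q =
     (SUP f\<in>{f \<in> H. rkhs_norm ip f \<le> 1}. ereal \<bar>gauss_mean f - Q f\<bar>)"

definition hermite_prob :: "nat \<Rightarrow> real \<Rightarrow> real" where
  "hermite_prob n x = (-1) ^ n * exp (x\<^sup>2 / 2) * (deriv ^^ n) (\<lambda>t. exp (- t\<^sup>2 / 2)) x"

definition mercer_alpha :: real where
  "mercer_alpha = 1 / sqrt 2"

definition mercer_eps :: "real \<Rightarrow> real" where
  "mercer_eps l = 1 / (sqrt 2 * l)"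

definition mercer_beta :: "real \<Rightarrow> real" where
  "mercer_beta l = (1 + (2 * mercer_eps l / mercer_alpha)\<^sup>2) powr (1 / 4)"

text \<open>This is the quantity \<open>\<delta>\<^sup>2\<close>; \<open>\<delta>\<close> itself never occurs.\<close>

definition mercer_delta_sq :: "real \<Rightarrow> real" where
  "mercer_delta_sq l = mercer_alpha\<^sup>2 / 2 * ((mercer_beta l)\<^sup>2 - 1)"

definition mercer_tau :: "real \<Rightarrow> real" where
  "mercer_tau l = sqrt ((1 / 2) / (1 / 2 + mercer_delta_sq l + (mercer_eps l)\<^sup>2))"

definition mercer_lambda :: "real \<Rightarrow> real" where
  "mercer_lambda l = (mercer_eps l)\<^sup>2 / (1 / 2 + mercer_delta_sq l + (mercer_eps l)\<^sup>2)"

definition mercer_phi :: "real \<Rightarrow> nat \<Rightarrow> real \<Rightarrow> real" where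
  "mercer_phi l n x = sqrt (mercer_beta l / fact n) * exp (- mercer_delta_sq l * x\<^sup>2)
     * hermite_prob n (sqrt 2 * mercer_alpha * mercer_beta l * x)"

end

theory Submission
  imports Defs "HOL-Complex_Analysis.Complex_Analysis"
begin

text \<open>
  Two inputs bound the error functional \<open>L = \<mu> - Q\<close>.  The first is
  \<open>(L f)\<^sup>2 \<le> \<Sum>n. \<tau> \<lambda>\<^sup>n (L \<phi>\<^sub>n)\<^sup>2\<close> on the unit ball of the reproducing kernel Hilbert space; by
  exactness only the terms \<open>n \<ge> M\<close> survive.  It follows from the Cauchy--Schwarz inequality for
  finite kernel combinations, with \<open>\<mu>\<close> obtained as a limit of averages of \<open>j\<close> independent point
  evaluations, and from Mehler's formula, which is the Mercer expansion of the Gaussian kernel.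
  The second is \<open>\<bar>L \<phi>\<^sub>n\<bar> \<le> 1 + K \<surd>\<beta> W exp (M / \<beta>\<^sup>2)\<close> for \<open>n \<ge> M\<close>, a consequence of Cramer's inequality
  \<open>\<bar>H\<^sub>n(y)\<bar> exp (- y\<^sup>2 / 4) \<le> K \<surd>(n!)\<close>.  The condition on the nodes means \<open>\<bar>\<beta> x\<bar> \<le> 2 \<surd>n\<close>, so Cramer's
  inequality is needed only in the oscillatory region \<open>\<bar>y\<bar> \<le> 2 \<surd>n\<close>.  There the Cauchy integral
  over the circle of radius \<open>\<surd>n\<close>, which passes through both saddle points, gives it with \<open>K = 1.087\<close>.
\<close>

section \<open>Hermite polynomials\<close>

text \<open>The eigenvalues decay geometrically, but Cramer's inequality controls an eigenfunction
  only up to a factor exp(x^2/4), because exp(- \<delta>^2 x^2) is weaker than the weight exp(-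
  (\<beta> x)^2 / 4) by exactly that factor. Nodes of size at most 2 sqrt M / \<beta> turn it into
  exp(M / \<beta>^2). The decay still wins because \<lambda> = (1 - 1/\<beta>^2) / (1 + 1/\<beta>^2)
  and 2 x < ln ((1 + x) / (1 - x)). The constant 1.087 leaves little slack. On the circle the
  modulus of Cauchy's integrand is a Gaussian in cos (2 pi t) + c, whose mean has no elementary
  form. The bound exp(- s) \<le> 1 / (1 + s) replaces it by a rational function of the cosine, whose
  mean is explicit for every c; no case split is needed near |c| = 1, where the two saddle points
  merge. Together with Stirling's bound the loss still fits for n \<ge> 3. Members of
  \<open>H\<close> are merely functions, so their measurability and integrability have to be derived
  from the kernel.\<close>

primrec hermite_poly :: "nat \<Rightarrow> 'a::field poly" where
  "hermite_poly 0 = 1"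
| "hermite_poly (Suc n) = [:0, 1:] * hermite_poly n - pderiv (hermite_poly n)"

text \<open>The Appell property. It turns the defining recursion, which involves a derivative, into
  the three-term recurrence.\<close>

lemma pderiv_hermite_poly_Suc:
  "pderiv (hermite_poly (Suc n)) = smult (of_nat (Suc n)) (hermite_poly n)"
proof (induction n)
  case 0
  then show ?case by (simp add: pderiv_pCons)
next
  case (Suc n)
  have "pderiv (hermite_poly (Suc (Suc n)) :: 'a poly) =
      pderiv ([:0, 1:] * hermite_poly (Suc n) - pderiv (hermite_poly (Suc n)))"
    by simp
  also have "\<dots> = hermite_poly (Suc n)
      + smult (of_nat (Suc n)) ([:0, 1:] * hermite_poly n - pderiv (hermite_poly n))"
    unfolding pderiv_diff pderiv_mult Suc.IH
    by (simp add: pderiv_smult pderiv_pCons smult_diff_right del: hermite_poly.simps of_nat_Suc)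
  also have "\<dots> = smult (of_nat (Suc (Suc n))) (hermite_poly (Suc n))"
    by (simp only: hermite_poly.simps(2)[symmetric] of_nat_Suc[of "Suc n"] smult_add_left
        smult_1_left)
  finally show ?case .
qed

lemma poly_hermite_poly_Suc_Suc:
  "poly (hermite_poly (Suc (Suc n))) x =
     x * poly (hermite_poly (Suc n)) x - of_nat (Suc n) * poly (hermite_poly n) x"
  by (subst hermite_poly.simps(2)) (simp add: pderiv_hermite_poly_Suc del: hermite_poly.simps)

text \<open>The polynomials are typed over an arbitrary field because Mehler's series and Cauchy's
  integral are complex while the theorem is real. Consecutive degrees are carried together since the
  recurrence reaches back two steps.\<close>

lemma poly_hermite_poly_of_real:
  "poly (hermite_poly n) (of_real x :: 'a::real_field) = of_real (poly (hermite_poly n) x)"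
proof -
  have "poly (hermite_poly n) (of_real x :: 'a) = of_real (poly (hermite_poly n) x) \<and>
    poly (hermite_poly (Suc n)) (of_real x :: 'a) = of_real (poly (hermite_poly (Suc n)) x)"
    by (induction n) (simp_all only: poly_hermite_poly_Suc_Suc, simp_all)
  thus ?thesis ..
qed

text \<open>Rodrigues' formula for real and complex arguments at once: over the reals it identifies
  \<open>hermite_prob\<close>, over the complex numbers it feeds Cauchy's integral for the
  derivatives of the Gaussian.\<close>

lemma higher_deriv_gaussian:
  "(deriv ^^ n) (\<lambda>t. exp (- t\<^sup>2 / 2)) =
     (\<lambda>x::'a::{banach,real_normed_field}. (-1) ^ n * poly (hermite_poly n) x * exp (- x\<^sup>2 / 2))"
proof (induction n)
  case (Suc n)
  have "deriv (\<lambda>x::'a. (-1) ^ n * poly (hermite_poly n) x * exp (- x\<^sup>2 / 2)) x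
     = (-1) ^ Suc n * poly (hermite_poly (Suc n)) x * exp (- x\<^sup>2 / 2)" for x
    by (rule DERIV_imp_deriv)
      (auto intro!: derivative_eq_intros poly_DERIV simp: algebra_simps)
  thus ?case unfolding funpow.simps o_apply Suc.IH by blast
qed simp

lemma hermite_prob_eq_poly: "hermite_prob n x = poly (hermite_poly n) x"
proof -
  have "exp (x\<^sup>2 / 2) * exp (- x\<^sup>2 / 2) = 1"
    by (simp flip: exp_add)
  hence "(-1) ^ n * exp (x\<^sup>2 / 2) * ((-1) ^ n * p * exp (- x\<^sup>2 / 2)) = p" for p :: real
    by (simp add: ac_simps flip: power_mult_distrib) 
  thus ?thesis
    unfolding hermite_prob_def higher_deriv_gaussian by simp
qed

lemma complex_higher_deriv_gaussian_of_real:
  "(deriv ^^ n) (\<lambda>t::complex. exp (- t\<^sup>2 / 2)) (of_real x) =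
     of_real ((-1) ^ n * exp (- x\<^sup>2 / 2) * hermite_prob n x)"
  unfolding higher_deriv_gaussian hermite_prob_eq_poly poly_hermite_poly_of_real
  by (simp flip: exp_of_real)

lemma hermite_prob_0: "hermite_prob 0 x = 1"
  and hermite_prob_1: "hermite_prob (Suc 0) x = x"
  and hermite_prob_Suc_Suc:
    "hermite_prob (Suc (Suc n)) x = x * hermite_prob (Suc n) x - real (Suc n) * hermite_prob n x"
  unfolding hermite_prob_eq_poly poly_hermite_poly_Suc_Suc by simp_all

section \<open>Mehler's formula\<close>

text \<open>
  The shifts \<open>i, j \<le> 1\<close> close under the three-term recurrence, so eliminating them leaves a linear
  first-order ODE for \<open>hermite_egf 0 0\<close>.  Mehler's closed form is analytic on the unit disc and
  satisfies the same ODE; no prior growth bound on the Hermite polynomials is needed.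
\<close>

definition hermite_egf :: "nat \<Rightarrow> nat \<Rightarrow> complex \<Rightarrow> complex \<Rightarrow> complex fps" where
  "hermite_egf i j x y =
     Abs_fps (\<lambda>n. poly (hermite_poly (n + i)) x * poly (hermite_poly (n + j)) y / fact n)"

lemma hermite_egf_step_left:
  "hermite_egf 1 0 x y = fps_const x * hermite_egf 0 0 x y - fps_X * hermite_egf 0 1 x y"
proof (rule fps_ext)
  fix n
  show "hermite_egf 1 0 x y $ n =
    (fps_const x * hermite_egf 0 0 x y - fps_X * hermite_egf 0 1 x y) $ n"
  proof (cases n)
    case (Suc m)
    thus ?thesis
      by (simp add: hermite_egf_def poly_hermite_poly_Suc_Suc field_simps
           del: hermite_poly.simps of_nat_Suc)
  qed (simp add: hermite_egf_def)
qed

lemma hermite_egf_step_right: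
  "hermite_egf 0 1 x y = fps_const y * hermite_egf 0 0 x y - fps_X * hermite_egf 1 0 x y"
proof (rule fps_ext)
  fix n
  show "hermite_egf 0 1 x y $ n =
    (fps_const y * hermite_egf 0 0 x y - fps_X * hermite_egf 1 0 x y) $ n"
  proof (cases n)
    case (Suc m)
    thus ?thesis
      by (simp add: hermite_egf_def poly_hermite_poly_Suc_Suc field_simps
           del: hermite_poly.simps of_nat_Suc)
  qed (simp add: hermite_egf_def)
qed

lemma hermite_egf_deriv: "fps_deriv (hermite_egf 0 0 x y) = hermite_egf 1 1 x y"
  by (rule fps_ext) (simp add: hermite_egf_def del: hermite_poly.simps of_nat_Suc)

text \<open>The recurrence in x produces the shift (0, 2), which the recurrence in y removes again.
  The weight m + 1 that this brings contributes A + t A' for A the unshifted series, and A' is the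
  (1, 1) series itself.\<close>

lemma hermite_egf_step_both:
  "hermite_egf 1 1 x y = fps_const x * hermite_egf 0 1 x y -
     fps_X * (fps_const y * hermite_egf 0 1 x y - hermite_egf 0 0 x y - fps_X * hermite_egf 1 1 x y)"
proof (rule fps_ext)
  fix n
  consider "n = 0" | "n = 1" | k where "n = Suc (Suc k)"
    by (metis One_nat_def not0_implies_Suc)
  thus "hermite_egf 1 1 x y $ n = (fps_const x * hermite_egf 0 1 x y -
     fps_X * (fps_const y * hermite_egf 0 1 x y - hermite_egf 0 0 x y - fps_X * hermite_egf 1 1 x y)) $ n"
  proof cases
    case 3
    thus ?thesis
      by (simp add: hermite_egf_def poly_hermite_poly_Suc_Suc field_simps
           del: hermite_poly.simps of_nat_Suc) (simp add: algebra_simps)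
  qed (simp_all add: hermite_egf_def pderiv_pCons algebra_simps)
qed

lemma hermite_egf_ODE:
  "(1 - fps_X\<^sup>2)\<^sup>2 * fps_deriv (hermite_egf 0 0 x y) =
     ((fps_const x - fps_X * fps_const y) * (fps_const y - fps_X * fps_const x)
       + fps_X * (1 - fps_X\<^sup>2)) * hermite_egf 0 0 x y"
proof -
  let ?A = "hermite_egf 0 0 x y" and ?C = "hermite_egf 0 1 x y" and ?D = "hermite_egf 1 1 x y"
  have 1: "(1 - fps_X\<^sup>2) * ?C = (fps_const y - fps_X * fps_const x) * ?A"
    using hermite_egf_step_left[of x y] hermite_egf_step_right[of x y] by algebra
  have 2: "(1 - fps_X\<^sup>2) * ?D = (fps_const x - fps_X * fps_const y) * ?C + fps_X * ?A"
    using hermite_egf_step_both[of x y] by algebra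
  show ?thesis unfolding hermite_egf_deriv using 1 2 by algebra
qed

section \<open>Mehler's closed form and uniqueness for its differential equation\<close>

definition mehler_fun :: "complex \<Rightarrow> complex \<Rightarrow> complex \<Rightarrow> complex" where
  "mehler_fun x y t = (1 - t\<^sup>2) powr (-1/2) *
     exp ((2 * t * x * y - t\<^sup>2 * (x\<^sup>2 + y\<^sup>2)) / (2 * (1 - t\<^sup>2)))"

text \<open>Keeps 1 - t^2 off the branch cut of the principal power throughout the unit
  disc.\<close>

lemma one_minus_square_notin_nonpos_Reals:
  fixes t :: complex
  assumes "norm t < 1"
  shows "1 - t\<^sup>2 \<notin> \<real>\<^sub>\<le>\<^sub>0"
proof
  assume "1 - t\<^sup>2 \<in> \<real>\<^sub>\<le>\<^sub>0"
  hence "1 \<le> Re (t\<^sup>2)" by (simp add: complex_nonpos_Reals_iff)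
  also have "\<dots> \<le> norm (t\<^sup>2)" by (rule complex_Re_le_cmod)
  also have "\<dots> < 1" using assms by (simp add: norm_power power_less_one_iff)
  finally show False by simp
qed

lemma one_minus_square_neq_0:
  fixes t :: complex
  assumes "norm t < 1"
  shows "1 - t\<^sup>2 \<noteq> 0"
  using one_minus_square_notin_nonpos_Reals[OF assms] by auto

lemma mehler_fun_has_field_derivative:
  assumes "norm t < 1"
  shows "(mehler_fun x y has_field_derivative
    ((x - t * y) * (y - t * x) + t * (1 - t\<^sup>2)) / (1 - t\<^sup>2)\<^sup>2 * mehler_fun x y t) (at t)"
proof -
  note nz = one_minus_square_neq_0[OF assms] one_minus_square_notin_nonpos_Reals[OF assms]
  define p where "p = (1 - t\<^sup>2) powr (-1/2)"
  define q where "q = 1 - t\<^sup>2"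
  define v where "v = 2 * t * x * y - t\<^sup>2 * (x\<^sup>2 + y\<^sup>2)"
  have powr: "(1 - t\<^sup>2) powr (-1/2 - 1) = p / q"
    using nz powr_diff[of "1 - t\<^sup>2" "-1/2" 1] by (simp add: p_def q_def)
  have "((\<lambda>t. (1 - t\<^sup>2) powr (-1/2)) has_field_derivative
      (-1/2) * (1 - t\<^sup>2) powr (-1/2 - 1) * (- (2 * t))) (at t)"
    by (rule derivative_eq_intros refl nz | simp)+
  hence 1: "((\<lambda>t. (1 - t\<^sup>2) powr (-1/2)) has_field_derivative t * p / q) (at t)"
    unfolding powr by (simp add: mult.commute)
  have 2: "((\<lambda>t. (2 * t * x * y - t\<^sup>2 * (x\<^sup>2 + y\<^sup>2)) / (2 * (1 - t\<^sup>2))) has_field_derivative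
      ((2 * x * y - 2 * t * (x\<^sup>2 + y\<^sup>2)) * (2 * q) - v * (2 * (- (2 * t)))) / (2 * q)\<^sup>2) (at t)"
    unfolding q_def v_def using nz(1) by (auto intro!: derivative_eq_intros simp: power2_eq_square)
  have "(mehler_fun x y has_field_derivative
      t * p / q * exp (v / (2 * q)) + exp (v / (2 * q)) *
        (((2 * x * y - 2 * t * (x\<^sup>2 + y\<^sup>2)) * (2 * q) - v * (2 * (- (2 * t)))) / (2 * q)\<^sup>2) * p) (at t)"
    unfolding mehler_fun_def[abs_def] using DERIV_mult[OF 1 DERIV_chain2[OF DERIV_exp 2]]
    by (simp add: p_def q_def v_def)
  also have "t * p / q * exp (v / (2 * q)) + exp (v / (2 * q)) *
        (((2 * x * y - 2 * t * (x\<^sup>2 + y\<^sup>2)) * (2 * q) - v * (2 * (- (2 * t)))) / (2 * q)\<^sup>2) * p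
    = (t * q + ((2 * x * y - 2 * t * (x\<^sup>2 + y\<^sup>2)) * (2 * q) + 4 * t * v) / 4) / q\<^sup>2 * (p * exp (v / (2 * q)))"
    using nz(1) by (simp add: q_def[symmetric] divide_simps) (simp add: algebra_simps power2_eq_square)
  also have "t * q + ((2 * x * y - 2 * t * (x\<^sup>2 + y\<^sup>2)) * (2 * q) + 4 * t * v) / 4 =
      (x - t * y) * (y - t * x) + t * (1 - t\<^sup>2)"
    by (simp add: q_def v_def field_simps power2_eq_square)
  finally show ?thesis by (simp add: mehler_fun_def[abs_def] p_def q_def v_def)
qed

lemma mehler_fun_holomorphic: "mehler_fun x y holomorphic_on ball 0 1"
proof (rule holomorphic_onI)
  fix t :: complex
  assume "t \<in> ball 0 1"
  hence "norm t < 1" by simp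
  thus "mehler_fun x y field_differentiable at t within ball 0 1"
    using mehler_fun_has_field_derivative field_differentiable_def field_differentiable_at_within
    by blast
qed

text \<open>Uniqueness for the ODE is proved among formal power series: the quotient of the two
  solutions has derivative zero and constant term one. Convergence of the Hermite series is thus a
  consequence, not a hypothesis.\<close>

lemma mehler_fun_has_fps_expansion: "mehler_fun x y has_fps_expansion hermite_egf 0 0 x y"
proof -
  let ?A = "hermite_egf 0 0 x y"
  define F where "F = fps_expansion (mehler_fun x y) 0"
  define R where "R = (fps_const x - fps_X * fps_const y) * (fps_const y - fps_X * fps_const x)
       + fps_X * (1 - fps_X\<^sup>2)"
  define P where "P = (1 - fps_X\<^sup>2 :: complex fps)\<^sup>2"
  have F: "mehler_fun x y has_fps_expansion F"
    unfolding F_def by (rule has_fps_expansion_fps_expansion[OF _ _ mehler_fun_holomorphic]) auto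
  have 1: "(\<lambda>t. (1 - t\<^sup>2)\<^sup>2 * deriv (mehler_fun x y) t) has_fps_expansion
      P * fps_deriv F"
    unfolding P_def by (intro fps_expansion_intros F)
  have 2: "(\<lambda>t. ((x - t * y) * (y - t * x) + t * (1 - t\<^sup>2)) * mehler_fun x y t)
      has_fps_expansion R * F"
    unfolding R_def by (intro fps_expansion_intros F)
  have "eventually (\<lambda>t. t \<in> ball 0 1) (nhds (0::complex))"
    by (rule eventually_nhds_in_open) auto
  hence "eventually (\<lambda>t. (1 - t\<^sup>2)\<^sup>2 * deriv (mehler_fun x y) t =
      ((x - t * y) * (y - t * x) + t * (1 - t\<^sup>2)) * mehler_fun x y t) (nhds 0)"
  proof eventually_elim
    case (elim t)
    hence "norm t < 1" by simp
    thus ?case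
      using one_minus_square_neq_0 by (simp add: DERIV_imp_deriv[OF mehler_fun_has_field_derivative])
  qed
  from iffD2[OF has_fps_expansion_cong[OF this refl] 2]
  have "(\<lambda>t. (1 - t\<^sup>2)\<^sup>2 * deriv (mehler_fun x y) t) has_fps_expansion R * F" .
  with 1 have ODE_F: "P * fps_deriv F = R * F"
    by (rule fps_expansion_unique_complex)
  have ODE_A: "P * fps_deriv ?A = R * ?A"
    unfolding P_def R_def by (rule hermite_egf_ODE)
  \<comment> \<open>\<open>P\<close> has constant term one and formal power series over a field form
    an integral domain, so \<open>P\<close> cancels and the Wronskian vanishes.\<close>
  have "P * (fps_deriv ?A * F) = P * (?A * fps_deriv F)"
  proof -
    have "P * (fps_deriv ?A * F) = P * fps_deriv ?A * F" by (simp only: mult.assoc)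
    also have "\<dots> = ?A * (R * F)" by (simp only: ODE_A mult_ac)
    also have "\<dots> = P * (?A * fps_deriv F)" by (simp only: ODE_F[symmetric]) (simp only: mult_ac)
    finally show ?thesis .
  qed
  moreover have "P $ 0 = 1"
    by (simp add: P_def fps_nth_power_0)
  hence "P \<noteq> 0" by auto
  ultimately have wronskian: "fps_deriv ?A * F = ?A * fps_deriv F" by simp
  have F0: "F $ 0 = 1"
    using has_fps_expansion_imp_0_eq_fps_nth_0[OF F] by (simp add: mehler_fun_def)
  hence inv: "F * inverse F = 1" by (simp add: inverse_mult_eq_1')
  have "fps_deriv (?A * inverse F) = 0"
  proof -
    have "fps_deriv (?A * inverse F) = fps_deriv ?A * inverse F - ?A * fps_deriv F * (inverse F)\<^sup>2"
      using F0 by (simp add: fps_inverse_deriv)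
    also have "fps_deriv ?A * inverse F = fps_deriv ?A * F * (inverse F)\<^sup>2"
      using inv by (metis mult.assoc mult.right_neutral power2_eq_square)
    finally show ?thesis using wronskian by simp
  qed
  hence "?A * inverse F = fps_const ((?A * inverse F) $ 0)" by (simp only: fps_deriv_eq_0_iff)
  also have "fps_nth (?A * inverse F) 0 = 1" by (simp add: hermite_egf_def F0)
  finally have const: "?A * inverse F = 1" by (simp only: fps_const_1_eq_1)
  have "?A = ?A * (F * inverse F)" by (simp only: inv mult_1_right)
  also have "\<dots> = ?A * inverse F * F" by (simp only: mult_ac)
  also have "\<dots> = F" by (simp only: const mult_1_left)
  finally have "?A = F" .
  thus ?thesis using F by simp
qed

lemma mehler_sums:
  fixes t x y :: real
  assumes t: "\<bar>t\<bar> < 1"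
  shows "(\<lambda>n. t ^ n * (hermite_prob n x * hermite_prob n y / fact n)) sums
     ((1 - t\<^sup>2) powr (-1/2) * exp ((2 * t * x * y - t\<^sup>2 * (x\<^sup>2 + y\<^sup>2)) / (2 * (1 - t\<^sup>2))))"
proof -
  have pos: "0 < 1 - t\<^sup>2" using t by (simp add: abs_square_less_1)
  have "(\<lambda>n. hermite_egf 0 0 (of_real x) (of_real y) $ n * complex_of_real t ^ n) sums
      mehler_fun (of_real x) (of_real y) (of_real t)"
    by (rule has_fps_expansion_imp_sums_complex[OF mehler_fun_has_fps_expansion, where r = 1])
      (use t mehler_fun_holomorphic[of "of_real x" "of_real y"] in \<open>auto simp: one_ereal_def\<close>)
  also have "(\<lambda>n. hermite_egf 0 0 (of_real x) (of_real y) $ n * of_real t ^ n) =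
     (\<lambda>n. complex_of_real (t ^ n * (hermite_prob n x * hermite_prob n y / fact n)))"
    by (simp add: hermite_egf_def poly_hermite_poly_of_real hermite_prob_eq_poly fun_eq_iff)
  also have "mehler_fun (of_real x) (of_real y) (of_real t) = complex_of_real
     ((1 - t\<^sup>2) powr (-1/2) * exp ((2 * t * x * y - t\<^sup>2 * (x\<^sup>2 + y\<^sup>2)) / (2 * (1 - t\<^sup>2))))"
    using pos powr_of_real[of "1 - t\<^sup>2" "-1/2"] by (simp add: mehler_fun_def flip: exp_of_real)
  finally show ?thesis unfolding sums_of_real_iff .
qed

section \<open>Cramer's inequality in the oscillatory region\<close>

text \<open>This is x < artanh x. It is used twice: with x = 1 / (2 n + 1) for Stirling's bound and
  with x = 1 / \<beta>^2 for the convergence rate.\<close>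

lemma two_mult_less_ln_quotient:
  fixes x :: real
  assumes "0 < x" "x < 1"
  shows "2 * x < ln ((1 + x) / (1 - x))"
proof -
  have "(\<lambda>x. ln (1 + x) - ln (1 - x) - 2 * x) 0 < (\<lambda>x::real. ln (1 + x) - ln (1 - x) - 2 * x) x"
  proof (rule DERIV_pos_imp_increasing_open[OF assms(1)])
    fix u :: real assume u: "0 < u" "u < x"
    have "((\<lambda>x::real. ln (1 + x) - ln (1 - x) - 2 * x) has_real_derivative
        (1 / (1 + u) - (-1) / (1 - u) - 2)) (at u)"
      using u assms by (auto intro!: derivative_eq_intros)
    moreover have "1 / (1 + u) - (-1) / (1 - u) - 2 = 2 * u\<^sup>2 / ((1 + u) * (1 - u))"
      using u assms by (simp add: divide_simps) (simp add: algebra_simps power2_eq_square)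
    moreover have "0 < 2 * u\<^sup>2 / ((1 + u) * (1 - u))" using u assms by simp
    ultimately show "\<exists>y. ((\<lambda>x::real. ln (1 + x) - ln (1 - x) - 2 * x) has_real_derivative y) (at u) \<and> 0 < y"
      by metis
  qed (use assms in \<open>auto intro!: continuous_intros\<close>)
  thus ?thesis using assms by (simp add: ln_div)
qed

text \<open>The ratio n! e^n / n^(n + 1/2) decreases, since (1 + 1/n)^(n + 1/2) \<ge> e, so its
  value at n = 3, about 2.577, bounds all later ones.\<close>

lemma fact_exp_bound:
  assumes "3 \<le> n"
  shows "fact n * exp (real n) / real n ^ n \<le> 13 / 5 * sqrt (real n)"
  using assms
proof (induction n rule: nat_induct_at_least)
  case base
  have "exp (3::real) = exp 1 ^ 3" by (simp flip: exp_of_nat_mult)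
  also have "\<dots> \<le> (272 / 100) ^ 3" by (intro power_mono) (use e_less_272 in auto)
  finally have "6 * exp (3::real) / 27 \<le> 13 / 5 * (173 / 100)" by (simp add: power3_eq_cube)
  also have "\<dots> \<le> 13 / 5 * sqrt 3"
    by (intro mult_left_mono real_le_rsqrt) (auto simp: power2_eq_square)
  finally show ?case by (simp add: fact_numeral)
next
  case (Suc n)
  hence n: "0 < real n" by simp
  have "2 * (1 / (2 * real n + 1)) < ln ((1 + 1 / (2 * real n + 1)) / (1 - 1 / (2 * real n + 1)))"
    by (rule two_mult_less_ln_quotient) (use n in auto)
  also have "(1 + 1 / (2 * real n + 1)) / (1 - 1 / (2 * real n + 1)) = real (Suc n) / real n"
    using n by (simp add: divide_simps)
  finally have "1 < (real n + 1 / 2) * ln (real (Suc n) / real n)"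
    using n by (simp add: field_simps)
  hence "exp 1 \<le> exp ((real n + 1 / 2) * ln (real (Suc n) / real n))" by simp
  also have "\<dots> = (real (Suc n) / real n) powr (real n + 1 / 2)"
    using n by (simp add: powr_def)
  also have "\<dots> = (real (Suc n) / real n) ^ n * sqrt (real (Suc n) / real n)"
    using n by (simp add: powr_add powr_realpow powr_half_sqrt)
  finally have e: "exp 1 \<le> (real (Suc n) / real n) ^ n * sqrt (real (Suc n) / real n)" .
  have "fact (Suc n) * exp (real (Suc n)) / real (Suc n) ^ Suc n =
      (fact n * exp (real n) / real n ^ n) * (exp 1 * (real n / real (Suc n)) ^ n)"
    using n by (simp add: exp_add power_divide field_simps del: of_nat_Suc)
      (simp add: exp_add algebra_simps)
  also have "\<dots> \<le> (13 / 5 * sqrt (real n)) *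
      ((real (Suc n) / real n) ^ n * sqrt (real (Suc n) / real n) * (real n / real (Suc n)) ^ n)"
    by (intro mult_mono Suc.IH e order.refl) auto
  also have "\<dots> = 13 / 5 * sqrt (real (Suc n)) * ((real (Suc n) / real n) * (real n / real (Suc n))) ^ n"
    using n unfolding power_mult_distrib real_sqrt_divide by (simp add: field_simps del: of_nat_Suc)
  also have "(real (Suc n) / real n) * (real n / real (Suc n)) = 1" using n by simp
  finally show ?case by simp
qed

section \<open>Means over circles\<close>

text \<open>Cauchy's formula with the circle parametrised by \<open>{0..1}\<close>, so that both
  uses are ordinary integrals over one interval: n = 0 is the mean value property, general n
  produces the Hermite polynomials.\<close>

lemma circle_mean_higher_deriv:
  assumes "continuous_on (cball z r) f" "f holomorphic_on ball z r" "0 < r"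
  shows "((\<lambda>t. f (z + of_real r * exp (2 * of_real pi * \<i> * of_real t)) *
            exp (2 * of_real pi * \<i> * of_real t) powi (- int n))
          has_integral of_real (r ^ n / fact n) * (deriv ^^ n) f z) {0..1}"
proof -
  define w where "w = (\<lambda>t::real. exp (2 * of_real pi * \<i> * of_real t))"
  have w: "w t \<noteq> 0" for t by (simp add: w_def)
  have "((\<lambda>u. f u / (u - z) ^ Suc n) has_contour_integral 2 * pi * \<i> / fact n * (deriv ^^ n) f z)
      (circlepath z r)"
    by (rule Cauchy_has_contour_integral_higher_derivative_circlepath) (use assms in auto)
  hence "((\<lambda>t. f (circlepath z r t) / (circlepath z r t - z) ^ Suc n *
      vector_derivative (circlepath z r) (at t)) has_integral 2 * pi * \<i> / fact n * (deriv ^^ n) f z) {0..1}"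
    unfolding has_contour_integral .
  hence "((\<lambda>t. of_real (r ^ n) / (2 * pi * \<i>) * (f (circlepath z r t) / (circlepath z r t - z) ^ Suc n *
      vector_derivative (circlepath z r) (at t))) has_integral
      of_real (r ^ n) / (2 * pi * \<i>) * (2 * pi * \<i> / fact n * (deriv ^^ n) f z)) {0..1}"
    by (rule has_integral_mult_right)
  moreover have "circlepath z r t = z + of_real r * w t" for t
    by (simp add: circlepath w_def)
  moreover have "vector_derivative (circlepath z r) (at t) = 2 * pi * \<i> * r * w t" for t
    by (simp add: vector_derivative_circlepath w_def)
  moreover have "of_real (r ^ n) / (2 * pi * \<i>) * (v / (z + of_real r * w t - z) ^ Suc n *
      (2 * pi * \<i> * r * w t)) = v * w t powi (- int n)" for t v
    using assms(3) w[of t] by (simp add: power_mult_distrib power_int_minus field_simps)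
  ultimately have "((\<lambda>t. f (z + of_real r * w t) * w t powi (- int n)) has_integral
      of_real (r ^ n) / (2 * pi * \<i>) * (2 * pi * \<i> / fact n * (deriv ^^ n) f z)) {0..1}"
    by (simp only:)
  moreover have "of_real (r ^ n) / (2 * pi * \<i>) * (2 * pi * \<i> / fact n * (deriv ^^ n) f z) =
      of_real (r ^ n / fact n) * (deriv ^^ n) f z"
    by (simp add: field_simps)
  ultimately show ?thesis by (simp only: w_def)
qed

text \<open>
  With \<open>w = exp (2 \<pi> \<i> t)\<close> one has \<open>2 \<zeta> (z + cos (2 \<pi> t)) = (1 + \<zeta> w) (1 + \<zeta> / w)\<close>, and after splitting
  into partial fractions both means are values at the centre of the disc.
\<close>

lemma circle_mean_shifted_cos:
  fixes z \<zeta> :: complex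
  assumes "\<zeta> \<noteq> 0" "norm \<zeta> < 1" "\<zeta> + 1 / \<zeta> = 2 * z"
  shows "((\<lambda>t. 1 / (z + of_real (cos (2 * pi * t)))) has_integral 2 * \<zeta> / (1 - \<zeta>\<^sup>2)) {0..1}"
proof -
  define w where "w = (\<lambda>t::real. exp (2 * of_real pi * \<i> * of_real t))"
  have w: "w t \<noteq> 0" "norm (w t) = 1" for t by (simp_all add: w_def)
  have cnj_w: "cnj (w t) = inverse (w t)" for t
    using w complex_cnj_cancel_iff by (metis divide_conv_cnj inverse_eq_divide mult_1)
  have cos_w: "of_real (cos (2 * pi * t)) = (w t + inverse (w t)) / 2" for t
    by (simp add: w_def cos_of_real[symmetric] cos_exp_eq exp_minus mult_ac)
  have nz: "1 + u * v \<noteq> 0" if "norm u < 1" "norm v \<le> 1" for u v :: complex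
  proof
    assume "1 + u * v = 0"
    hence "u * v = -1" by (metis add_eq_0_iff)
    hence "norm u * norm v = 1" by (metis norm_minus_cancel norm_mult norm_one)
    moreover have "norm u * norm v \<le> norm u * 1"
      by (rule mult_left_mono) (use that in auto)
    ultimately show False using that by simp
  qed
  have mean1: "((\<lambda>t. 1 / (1 + u * w t)) has_integral 1) {0..1}"
    and mean0: "((\<lambda>t. u * w t / (1 + u * w t)) has_integral 0) {0..1}" if u: "norm u < 1" for u
  proof -
    have "continuous_on (cball 0 1) (\<lambda>v. 1 / (1 + u * v))"
      and "continuous_on (cball 0 1) (\<lambda>v. u * v / (1 + u * v))"
      and "(\<lambda>v. 1 / (1 + u * v)) holomorphic_on ball 0 1"
      and "(\<lambda>v. u * v / (1 + u * v)) holomorphic_on ball 0 1"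
      using nz[OF u] by (auto intro!: holomorphic_intros continuous_intros)
    with circle_mean_higher_deriv[of 0 1 "\<lambda>v. 1 / (1 + u * v)" 0]
      circle_mean_higher_deriv[of 0 1 "\<lambda>v. u * v / (1 + u * v)" 0]
    show "((\<lambda>t. 1 / (1 + u * w t)) has_integral 1) {0..1}"
      and "((\<lambda>t. u * w t / (1 + u * w t)) has_integral 0) {0..1}"
      by (simp_all add: w_def)
  qed
  \<comment> \<open>1 / w is singular at the centre of the disc, but on the unit circle it is the
    conjugate of w, so this mean follows from the previous one by conjugation.\<close>
  have "((\<lambda>t. cnj (cnj \<zeta> * w t / (1 + cnj \<zeta> * w t))) has_integral cnj 0) {0..1}"
    using has_integral_cnj[THEN iffD2, OF mean0[of "cnj \<zeta>"]] assms by (simp add: o_def)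
  hence mean0': "((\<lambda>t. \<zeta> * inverse (w t) / (1 + \<zeta> * inverse (w t))) has_integral 0) {0..1}"
    by (simp add: cnj_w)
  have nz2: "1 - \<zeta>\<^sup>2 \<noteq> 0"
    using nz[of \<zeta> "-\<zeta>"] assms by (simp add: power2_eq_square)
  have "((\<lambda>t. 2 * \<zeta> / (1 - \<zeta>\<^sup>2) * (1 / (1 + \<zeta> * w t) - \<zeta> * inverse (w t) / (1 + \<zeta> * inverse (w t))))
      has_integral 2 * \<zeta> / (1 - \<zeta>\<^sup>2) * (1 - 0)) {0..1}"
    by (intro has_integral_mult_right has_integral_diff mean1 mean0' assms)
  moreover have "2 * \<zeta> / (1 - \<zeta>\<^sup>2) * (1 / (1 + \<zeta> * w t) - \<zeta> * inverse (w t) / (1 + \<zeta> * inverse (w t)))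
      = 1 / (z + of_real (cos (2 * pi * t)))" for t
  proof -
    define a where "a = 1 + \<zeta> * w t"
    define b where "b = 1 + \<zeta> * inverse (w t)"
    have ab: "a \<noteq> 0" "b \<noteq> 0"
      unfolding a_def b_def using nz[of \<zeta> "w t"] nz[of \<zeta> "inverse (w t)"] w assms
      by (auto simp: norm_inverse)
    have 1: "b - \<zeta> * inverse (w t) * a = 1 - \<zeta>\<^sup>2"
      using w[of t] by (simp add: a_def b_def field_simps power2_eq_square)
    have 2: "a * b = 2 * \<zeta> * (z + of_real (cos (2 * pi * t)))"
    proof -
      have "2 * \<zeta> * z = \<zeta>\<^sup>2 + 1"
        using assms(1,3) by (simp add: field_simps power2_eq_square)
      moreover have "a * b = 1 + \<zeta>\<^sup>2 * (w t * inverse (w t)) + \<zeta> * (w t + inverse (w t))"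
        unfolding a_def b_def by (simp add: algebra_simps power2_eq_square)
      ultimately show ?thesis
        using w(1)[of t] unfolding cos_w by (simp add: distrib_left add.commute)
    qed
    have "1 / a - \<zeta> * inverse (w t) / b = (1 - \<zeta>\<^sup>2) / (a * b)"
      using ab by (simp add: 1[symmetric] diff_divide_eq_iff divide_diff_eq_iff field_simps del: inverse_eq_divide)
    thus ?thesis
      using nz2 assms(1) by (simp add: 2 a_def[symmetric] b_def[symmetric])
  qed
  ultimately show ?thesis by simp
qed

text \<open>The two roots of u + 1/u = 2 z are mutually inverse. On the unit circle u + 1/u would be
  real, so one root lies strictly inside.\<close>

lemma exists_joukowski_preimage:
  assumes "Im z \<noteq> 0"
  obtains \<zeta> where "\<zeta> \<noteq> 0" "norm \<zeta> < 1" "\<zeta> + 1 / \<zeta> = 2 * z"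
proof -
  define u where "u = z + csqrt (z\<^sup>2 - 1)"
  have "u * (2 * z - u) = 1"
    by (simp add: u_def algebra_simps flip: power2_eq_square)
  moreover from this have u0: "u \<noteq> 0" by auto
  ultimately have u: "u + 1 / u = 2 * z" by (metis add_diff_cancel_left' diff_add_cancel nonzero_mult_div_cancel_left add.commute)
  have "norm u \<noteq> 1"
  proof
    assume "norm u = 1"
    hence "1 / u = cnj u" by (metis divide_conv_cnj mult_1)
    hence "Im (u + 1 / u) = 0" by simp
    thus False using assms by (simp add: u)
  qed
  then consider "norm u < 1" | "1 < norm u" by linarith
  thus ?thesis
  proof cases
    case 1
    thus ?thesis using that u0 u by blast
  next
    case 2
    thus ?thesis using that[of "1 / u"] u0 u by (simp add: norm_divide add.commute)
  qed
qed

text \<open>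
  The integrand is \<open>- \<sigma> Im (1 / (z + cos (2 \<pi> t)))\<close> for \<open>z = c + \<i> \<sigma>\<close>.  The mean \<open>S\<close> of
  \<open>1 / (z + cos (2 \<pi> t))\<close> satisfies \<open>S\<^sup>2 = 1 / (z\<^sup>2 - 1)\<close>, which determines \<open>(Im S)\<^sup>2\<close> without choosing a
  branch of the square root.
\<close>

lemma circle_mean_cauchy_bound:
  assumes "0 < \<sigma>"
  obtains J where "((\<lambda>t. 1 / (1 + ((cos (2 * pi * t) + c) / \<sigma>)\<^sup>2)) has_integral J) {0..1}"
    and "J\<^sup>2 = \<sigma>\<^sup>2 * (sqrt ((1 + \<sigma>\<^sup>2 - c\<^sup>2)\<^sup>2 + 4 * c\<^sup>2 * \<sigma>\<^sup>2) + (1 + \<sigma>\<^sup>2 - c\<^sup>2)) /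
           (2 * ((1 + \<sigma>\<^sup>2 - c\<^sup>2)\<^sup>2 + 4 * c\<^sup>2 * \<sigma>\<^sup>2))"
proof -
  define z where "z = Complex c \<sigma>"
  obtain \<zeta> where \<zeta>: "\<zeta> \<noteq> 0" "norm \<zeta> < 1" "\<zeta> + 1 / \<zeta> = 2 * z"
    using exists_joukowski_preimage[of z] assms by (auto simp: z_def)
  define S where "S = 2 * \<zeta> / (1 - \<zeta>\<^sup>2)"
  define D where "D = norm (z\<^sup>2 - 1)"
  define P where "P = 1 + \<sigma>\<^sup>2 - c\<^sup>2"
  have "((\<lambda>t. Im (1 / (z + of_real (cos (2 * pi * t))))) has_integral Im S) {0..1}"
    unfolding S_def by (rule has_integral_Im[OF circle_mean_shifted_cos[OF \<zeta>]])
  hence "((\<lambda>t. - \<sigma> * Im (1 / (z + of_real (cos (2 * pi * t))))) has_integral - \<sigma> * Im S) {0..1}"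
    by (rule has_integral_mult_right)
  moreover have "- \<sigma> * Im (1 / (z + of_real (cos (2 * pi * t)))) = 1 / (1 + ((cos (2 * pi * t) + c) / \<sigma>)\<^sup>2)" for t
    using assms by (simp add: z_def Im_divide complex_of_real_def field_simps power2_eq_square)
  ultimately have 1: "((\<lambda>t. 1 / (1 + ((cos (2 * pi * t) + c) / \<sigma>)\<^sup>2)) has_integral - \<sigma> * Im S) {0..1}"
    by simp
  have z2: "Re (z\<^sup>2 - 1) = - P" "Im (z\<^sup>2 - 1) = 2 * c * \<sigma>"
    by (simp_all add: z_def P_def power2_eq_square)
  have D2: "D\<^sup>2 = P\<^sup>2 + 4 * c\<^sup>2 * \<sigma>\<^sup>2"
    unfolding D_def cmod_power2 z2 by (simp add: power_mult_distrib)
  have "D \<noteq> 0"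
  proof
    assume "D = 0"
    hence "P = 0" "c = 0" using D2 assms by (auto simp: add_nonneg_eq_0_iff)
    thus False using assms by (simp add: P_def add_nonneg_eq_0_iff)
  qed
  hence "0 < D" by (simp add: D_def)
  hence sq: "z\<^sup>2 - 1 \<noteq> 0" by (auto simp: D_def)
  have "1 - \<zeta>\<^sup>2 \<noteq> 0"
  proof
    assume "1 - \<zeta>\<^sup>2 = 0"
    hence "norm (\<zeta>\<^sup>2) = 1" by simp
    moreover have "(norm \<zeta>)\<^sup>2 < 1" using \<zeta>(2) by (simp add: power_less_one_iff)
    ultimately show False by (simp add: norm_power)
  qed
  moreover have "(2 * \<zeta> * z)\<^sup>2 = (\<zeta>\<^sup>2 + 1)\<^sup>2"
    using \<zeta>(1,3) by (simp add: field_simps power2_eq_square)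
  hence "4 * \<zeta>\<^sup>2 * (z\<^sup>2 - 1) = (1 - \<zeta>\<^sup>2)\<^sup>2" by algebra
  ultimately have "S\<^sup>2 * (z\<^sup>2 - 1) = 1"
    by (simp add: S_def power_divide power_mult_distrib)
  hence S2: "S\<^sup>2 = 1 / (z\<^sup>2 - 1)" using sq by (simp add: field_simps)
  \<comment> \<open>The modulus of S^2 is the sum, and its real part the difference, of the squares
    of \<open>Re S\<close> and \<open>Im S\<close>; half the gap between the two is (Im
    S)^2.\<close>
  have "(Re S)\<^sup>2 + (Im S)\<^sup>2 = norm (S\<^sup>2)" by (simp add: norm_power cmod_power2)
  also have "\<dots> = 1 / D" by (simp add: S2 D_def norm_divide)
  finally have "(Re S)\<^sup>2 + (Im S)\<^sup>2 = 1 / D" .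
  moreover have "(Re S)\<^sup>2 - (Im S)\<^sup>2 = Re (S\<^sup>2)" by (simp add: power2_eq_square)
  hence "(Re S)\<^sup>2 - (Im S)\<^sup>2 = - P / D\<^sup>2"
    unfolding S2 Re_divide D_def cmod_power2 z2 by simp
  ultimately have "(Im S)\<^sup>2 = (1 / D + P / D\<^sup>2) / 2" by simp
  also have "\<dots> = (D + P) / (2 * D\<^sup>2)"
    using \<open>0 < D\<close> by (simp add: field_simps power2_eq_square)
  finally have "(- \<sigma> * Im S)\<^sup>2 = \<sigma>\<^sup>2 * (D + P) / (2 * D\<^sup>2)" by (simp add: power_mult_distrib)
  moreover have "D = sqrt (P\<^sup>2 + 4 * c\<^sup>2 * \<sigma>\<^sup>2)"
    using D2 \<open>0 < D\<close> by (metis less_imp_le real_sqrt_unique)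
  ultimately show ?thesis using that[OF 1] D2 by (simp add: P_def)
qed

text \<open>Completing the square gives Re ((y + r w)^2) = 2 n (cos + c)^2 + 2 n c^2 - n on the
  circle of radius r = sqrt n about y, so the modulus peaks where the cosine equals - c, at the
  saddle points. Of the two factors exp(- n c^2) in exp(- y^2 / 2), one cancels and the other stays
  as Cramer's weight exp(- y^2 / 4).\<close>

lemma hermite_le_circle_mean:
  assumes n: "1 \<le> n" and I: "((\<lambda>t. exp (- real n * (cos (2 * pi * t) + c)\<^sup>2)) has_integral I) {0..1}"
  shows "\<bar>hermite_prob n (2 * sqrt (real n) * c)\<bar> * exp (- real n * c\<^sup>2) \<le>
     fact n * (exp (real n / 2) / sqrt (real n) ^ n) * I"
proof -
  define r where "r = sqrt (real n)"
  define y where "y = 2 * r * c"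
  have r: "0 < r" "r\<^sup>2 = real n" using n by (simp_all add: r_def)
  define F where "F = (\<lambda>z::complex. exp (- z\<^sup>2 / 2))"
  define w where "w = (\<lambda>t::real. exp (2 * of_real pi * \<i> * of_real t))"
  have norm_w: "norm (w t) = 1" for t by (simp add: w_def)
  have w_eq: "w t = Complex (cos (2 * pi * t)) (sin (2 * pi * t))" for t
    by (simp add: w_def exp_eq_polar cis.code mult_ac complex_eq_iff Re_exp Im_exp)
  have norm_F: "norm (F (of_real y + of_real r * w t)) =
      exp (real n / 2 - real n * c\<^sup>2) * exp (- real n * (cos (2 * pi * t) + c)\<^sup>2)" for t
  proof -
    define C where "C = cos (2 * pi * t)"
    have "Re ((of_real y + of_real r * w t)\<^sup>2) = (y + r * C)\<^sup>2 - r\<^sup>2 * (sin (2 * pi * t))\<^sup>2"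
      by (simp add: w_eq C_def power2_eq_square algebra_simps)
    also have "\<dots> = 2 * r\<^sup>2 * (C + c)\<^sup>2 + 2 * r\<^sup>2 * c\<^sup>2 - r\<^sup>2"
      by (simp add: y_def C_def sin_squared_eq) (simp add: power2_eq_square algebra_simps)
    finally have "Re (- (of_real y + of_real r * w t)\<^sup>2 / 2) =
       (real n / 2 - real n * c\<^sup>2) + (- real n * (C + c)\<^sup>2)"
      by (simp add: r(2) diff_divide_distrib add_divide_distrib)
    thus ?thesis unfolding F_def norm_exp_eq_Re exp_add[symmetric] C_def by presburger
  qed
  have A: "((\<lambda>t. F (of_real y + of_real r * w t) * w t powi (- int n)) has_integral
      of_real (r ^ n / fact n) * (deriv ^^ n) F (of_real y)) {0..1}"
    unfolding w_def by (rule circle_mean_higher_deriv)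
      (auto simp: F_def r intro!: holomorphic_intros continuous_intros)
  have B: "((\<lambda>t. exp (real n / 2 - real n * c\<^sup>2) * exp (- real n * (cos (2 * pi * t) + c)\<^sup>2))
      has_integral exp (real n / 2 - real n * c\<^sup>2) * I) {0..1}"
    by (rule has_integral_mult_right[OF I])
  have "norm (of_real (r ^ n / fact n) * (deriv ^^ n) F (of_real y)) \<le>
      (exp (real n / 2 - real n * c\<^sup>2) * I) \<bullet> 1"
    by (rule has_integral_norm_bound_integral_component[OF A B])
      (simp add: norm_mult norm_F norm_w norm_power_int)
  hence "norm (of_real (r ^ n / fact n) * (deriv ^^ n) F (of_real y)) \<le>
      exp (real n / 2 - real n * c\<^sup>2) * I"
    by simp
  moreover have "norm (of_real (r ^ n / fact n) * (deriv ^^ n) F (of_real y)) =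
      r ^ n / fact n * exp (- y\<^sup>2 / 2) * \<bar>hermite_prob n y\<bar>"
    unfolding F_def complex_higher_deriv_gaussian_of_real norm_mult norm_of_real
    using r(1) by (simp add: abs_mult power_abs)
  moreover have "exp (- y\<^sup>2 / 2) = exp (- real n * c\<^sup>2) * exp (- real n * c\<^sup>2)"
    unfolding exp_add[symmetric] by (simp add: y_def power_mult_distrib r(2))
  moreover have "exp (real n / 2 - real n * c\<^sup>2) = exp (real n / 2) * exp (- real n * c\<^sup>2)"
    unfolding exp_add[symmetric] by simp
  ultimately have "exp (- real n * c\<^sup>2) * (r ^ n / fact n * (\<bar>hermite_prob n y\<bar> * exp (- real n * c\<^sup>2)))
     \<le> exp (- real n * c\<^sup>2) * (exp (real n / 2) * I)"
    by (simp only: mult_ac)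
  hence "r ^ n / fact n * (\<bar>hermite_prob n y\<bar> * exp (- real n * c\<^sup>2)) \<le> exp (real n / 2) * I"
    by (rule mult_left_le_imp_le) simp
  thus ?thesis
    using r(1) by (simp add: y_def r_def[symmetric] field_simps)
qed

section \<open>Low degrees and the numerical constant\<close>

lemma hermite_prob_bound_2:
  "(hermite_prob 2 y)\<^sup>2 * exp (- y\<^sup>2 / 2) \<le> 2 * (1087 / 1000)\<^sup>2"
proof -
  define s where "s = y\<^sup>2"
  have s: "0 \<le> s" by (simp add: s_def)
  have he: "hermite_prob 2 y = s - 1"
    using hermite_prob_Suc_Suc[of 0 y]
    by (simp add: hermite_prob_0 hermite_prob_1 s_def power2_eq_square numeral_2_eq_2)
  \<comment> \<open>Replacing exp(s/4) by its quadratic Taylor polynomial before squaring leaves a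
    quartic inequality in s.\<close>
  have "(1 + s / 4 + (s / 4)\<^sup>2 / 2)\<^sup>2 \<le> (exp (s / 4))\<^sup>2"
    by (intro power_mono exp_lower_Taylor_quadratic) (use s in auto)
  also have "\<dots> = exp (s / 2)" by (simp flip: exp_of_nat_mult)
  finally have e: "(1 + s / 4 + (s / 4)\<^sup>2 / 2)\<^sup>2 \<le> exp (s / 2)" .
  \<comment> \<open>A certificate for the quartic inequality; \<open>236 / 100\<close> lies just
    below 2 (1.087)^2 = 2.363138.\<close>
  have "0 \<le> s * (s * (s - 6)\<^sup>2)" "0 \<le> s * (s - 31 / 5)\<^sup>2" "0 \<le> (s - 5)\<^sup>2" using s by simp_all
  hence "(s - 1)\<^sup>2 \<le> 236 / 100 * (1 + s / 4 + (s / 4)\<^sup>2 / 2)\<^sup>2"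
    using s by (simp add: power2_eq_square algebra_simps)
  also have "\<dots> \<le> 2 * (1087 / 1000)\<^sup>2 * exp (s / 2)"
    by (rule mult_mono[OF _ e]) (auto simp: power2_eq_square)
  finally have "(s - 1)\<^sup>2 \<le> 2 * (1087 / 1000)\<^sup>2 * exp (s / 2)" .
  hence "(s - 1)\<^sup>2 * exp (- s / 2) \<le> 2 * (1087 / 1000)\<^sup>2 * exp (s / 2) * exp (- s / 2)"
    by (rule mult_right_mono) simp
  also have "\<dots> = 2 * (1087 / 1000)\<^sup>2"
    by (simp only: mult.assoc exp_add[symmetric]) simp
  finally show ?thesis by (simp add: he s_def)
qed

lemma hermite_prob_bound_1:
  "(hermite_prob 1 y)\<^sup>2 * exp (- y\<^sup>2 / 2) \<le> (1087 / 1000)\<^sup>2"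
proof -
  have "y\<^sup>2 / 2 \<le> exp (y\<^sup>2 / 2 - 1)" using exp_ge_add_one_self[of "y\<^sup>2 / 2 - 1"] by simp
  also have "\<dots> = exp (y\<^sup>2 / 2) / exp 1" by (simp add: exp_diff)
  also have "\<dots> \<le> exp (y\<^sup>2 / 2) / 2"
    using exp_ge_add_one_self[of 1] by (intro divide_left_mono) auto
  finally have "y\<^sup>2 \<le> exp (y\<^sup>2 / 2)" by simp
  hence "y\<^sup>2 * exp (- y\<^sup>2 / 2) \<le> exp (y\<^sup>2 / 2) * exp (- y\<^sup>2 / 2)"
    by (rule mult_right_mono) simp
  also have "\<dots> = 1" by (simp flip: exp_add)
  also have "1 \<le> (1087 / 1000 :: real)\<^sup>2" by (simp add: power2_eq_square)
  finally show ?thesis by (simp add: hermite_prob_1)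
qed

text \<open>
  In terms of \<open>q = P - 2 \<sigma>\<^sup>2\<close> one has \<open>D\<^sup>2 = q\<^sup>2 + 4 \<sigma>\<^sup>2\<close>; the constant \<open>215 / 100\<close> below approximates
  the value of \<open>D / \<sigma>\<close> at the critical \<open>q\<close>.  For \<open>\<sigma>\<^sup>2 = 1 / n\<close> the estimate fails when \<open>n \<le> 2\<close>.
\<close>

lemma cauchy_mean_estimate:
  fixes \<sigma> c :: real
  assumes "0 < \<sigma>" "\<sigma>\<^sup>2 \<le> 1 / 3"
  defines "P \<equiv> 1 + \<sigma>\<^sup>2 - c\<^sup>2"
  defines "D \<equiv> sqrt (P\<^sup>2 + 4 * c\<^sup>2 * \<sigma>\<^sup>2)"
  shows "13 / 10 * (\<sigma> * D + \<sigma> * P) / D\<^sup>2 \<le> (1087 / 1000)\<^sup>2"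
proof -
  define q where "q = P - 2 * \<sigma>\<^sup>2"
  have "D\<^sup>2 = P\<^sup>2 + 4 * c\<^sup>2 * \<sigma>\<^sup>2" by (simp add: D_def)
  hence Dq: "D\<^sup>2 = q\<^sup>2 + 4 * \<sigma>\<^sup>2"
    unfolding q_def P_def by (simp add: power2_eq_square algebra_simps)
  have pos: "0 < D\<^sup>2" unfolding Dq using assms(1) by (simp add: add_nonneg_pos)
  \<comment> \<open>1 / sqrt 3 rounded up.\<close>
  have "\<sigma> \<le> 5774 / 10000"
  proof (rule power2_le_imp_le)
    show "\<sigma>\<^sup>2 \<le> (5774 / 10000)\<^sup>2" using assms(2) by (simp add: power2_eq_square)
  qed simp
  have "0 \<le> (D - 215 / 100 * \<sigma>)\<^sup>2" by simp
  hence 1: "\<sigma> * D \<le> 100 / 430 * D\<^sup>2 + 215 / 200 * \<sigma>\<^sup>2"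
    by (simp add: power2_eq_square algebra_simps)
  have "\<sigma> * P = \<sigma> * q + 2 * \<sigma> * \<sigma>\<^sup>2" by (simp add: q_def algebra_simps)
  also have "2 * \<sigma> * \<sigma>\<^sup>2 \<le> 2 * (5774 / 10000) * \<sigma>\<^sup>2"
    by (intro mult_right_mono) (use \<open>\<sigma> \<le> 5774 / 10000\<close> in auto)
  finally have 2: "\<sigma> * P \<le> \<sigma> * q + 11548 / 10000 * \<sigma>\<^sup>2" by simp
  have "0 \<le> (\<sigma> - 11 / 10 * q)\<^sup>2" by simp
  hence "0 \<le> \<sigma>\<^sup>2 - 22 / 10 * (\<sigma> * q) + 121 / 100 * q\<^sup>2"
    by (simp add: power2_eq_square algebra_simps)
  \<comment> \<open>\<open>9088 / 10000\<close> is the largest four-place decimal whose product with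
    \<open>13 / 10\<close> stays below (1.087)^2 = 1.181569.\<close>
  hence "\<sigma> * D + \<sigma> * P \<le> 9088 / 10000 * D\<^sup>2"
    using 1 2 Dq zero_le_power2[of q] zero_le_power2[of \<sigma>] by linarith
  hence "13 / 10 * (\<sigma> * D + \<sigma> * P) \<le> (13 / 10 * (9088 / 10000)) * D\<^sup>2"
    by simp
  also have "\<dots> \<le> (1087 / 1000)\<^sup>2 * D\<^sup>2"
    by (rule mult_right_mono) (simp_all add: power2_eq_square)
  finally have "13 / 10 * (\<sigma> * D + \<sigma> * P) \<le> (1087 / 1000)\<^sup>2 * D\<^sup>2" .
  thus ?thesis using pos by (simp add: pos_divide_le_eq)
qed

text \<open>After squaring, Stirling's factor (13/5) sqrt n meets \<open>J\<^sup>2\<close>, which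
  carries \<sigma>^2 / 2. For \<sigma> = 1 / sqrt n the product sqrt n \<sigma>^2 is just \<sigma>,
  which gives the expression in \<open>cauchy_mean_estimate\<close>; its 13/10 is half of
  13/5.\<close>

lemma cramer_bound_oscillatory:
  assumes n: "1 \<le> n" and y: "y\<^sup>2 \<le> 4 * real n"
  shows "\<bar>hermite_prob n y\<bar> * exp (- y\<^sup>2 / 4) \<le> 1087 / 1000 * sqrt (fact n)"
proof -
  have "(hermite_prob n y)\<^sup>2 * exp (- y\<^sup>2 / 2) \<le> fact n * (1087 / 1000)\<^sup>2"
  proof -
    consider "n = 1" | "n = 2" | "3 \<le> n" using n by linarith
    thus ?thesis
    proof cases
      case 1
      thus ?thesis using hermite_prob_bound_1 by simp
    next
      case 2
      thus ?thesis using hermite_prob_bound_2 by simp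
    next
      case 3
      define \<sigma> where "\<sigma> = 1 / sqrt (real n)"
      define c where "c = y / (2 * sqrt (real n))"
      have \<sigma>: "0 < \<sigma>" "\<sigma>\<^sup>2 = 1 / real n"
        using n by (simp_all add: \<sigma>_def power_divide)
      have y_eq: "y = 2 * sqrt (real n) * c" using n by (simp add: c_def)
      hence y2: "y\<^sup>2 = 4 * real n * c\<^sup>2" by (simp add: power_mult_distrib)
      define P where "P = 1 + \<sigma>\<^sup>2 - c\<^sup>2"
      define D where "D = sqrt (P\<^sup>2 + 4 * c\<^sup>2 * \<sigma>\<^sup>2)"
      have D2: "D\<^sup>2 = P\<^sup>2 + 4 * c\<^sup>2 * \<sigma>\<^sup>2" by (simp add: D_def)
      obtain J where J: "((\<lambda>t. 1 / (1 + ((cos (2 * pi * t) + c) / \<sigma>)\<^sup>2)) has_integral J) {0..1}"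
        and J2: "J\<^sup>2 = \<sigma>\<^sup>2 * (D + P) / (2 * D\<^sup>2)"
        using circle_mean_cauchy_bound[OF \<sigma>(1), of c, folded P_def, folded D2 D_def] by blast
      define g where "g = (\<lambda>t. exp (- real n * (cos (2 * pi * t) + c)\<^sup>2))"
      have "g integrable_on {0..1}"
        unfolding g_def by (intro integrable_continuous_real continuous_intros)
      then obtain I where I: "(g has_integral I) {0..1}" by blast
      have "I \<le> J"
      proof (rule has_integral_le[OF I J])
        fix t :: real
        define s where "s = real n * (cos (2 * pi * t) + c)\<^sup>2"
        have "((cos (2 * pi * t) + c) / \<sigma>)\<^sup>2 = s"
          unfolding power_divide \<sigma>(2) s_def using n by simp
        moreover have "exp (- s) \<le> 1 / (1 + s)"
          using exp_ge_add_one_self[of s]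
          by (simp add: exp_minus s_def divide_simps add_pos_nonneg)
        ultimately show "g t \<le> 1 / (1 + ((cos (2 * pi * t) + c) / \<sigma>)\<^sup>2)"
          by (simp add: g_def s_def)
      qed
      have "0 \<le> I" by (rule has_integral_nonneg[OF I]) (simp add: g_def)
      have "\<bar>hermite_prob n y\<bar> * exp (- real n * c\<^sup>2) \<le>
          fact n * (exp (real n / 2) / sqrt (real n) ^ n) * I"
        unfolding y_eq by (rule hermite_le_circle_mean[OF n I[unfolded g_def]])
      hence "(\<bar>hermite_prob n y\<bar> * exp (- real n * c\<^sup>2))\<^sup>2 \<le>
          (fact n * (exp (real n / 2) / sqrt (real n) ^ n) * I)\<^sup>2"
        by (rule power_mono) simp
      also have "(\<bar>hermite_prob n y\<bar> * exp (- real n * c\<^sup>2))\<^sup>2 = (hermite_prob n y)\<^sup>2 * exp (- y\<^sup>2 / 2)"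
        by (simp add: power_mult_distrib y2 flip: exp_of_nat_mult)
      also have "(fact n * (exp (real n / 2) / sqrt (real n) ^ n) * I)\<^sup>2 =
          fact n * (fact n * exp (real n) / real n ^ n) * I\<^sup>2"
      proof -
        have "(exp (real n / 2))\<^sup>2 = exp (real n)" by (simp flip: exp_of_nat_mult)
        moreover have "(sqrt (real n) ^ n)\<^sup>2 = real n ^ n"
          by (metis mult.commute of_nat_0_le_iff power_mult real_sqrt_pow2)
        ultimately show ?thesis
          by (simp add: power_mult_distrib power_divide power2_eq_square[of "fact n"])
      qed
      also have "\<dots> \<le> fact n * (13 / 5 * sqrt (real n)) * J\<^sup>2"
        by (intro mult_mono power_mono fact_exp_bound[OF 3] order.refl \<open>I \<le> J\<close> \<open>0 \<le> I\<close>) auto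
      also have "\<dots> \<le> fact n * (1087 / 1000)\<^sup>2"
      proof -
        have "sqrt (real n) * \<sigma> = 1" using n by (simp add: \<sigma>_def)
        hence "sqrt (real n) * \<sigma>\<^sup>2 = \<sigma>"
          by (simp add: power2_eq_square flip: mult.assoc)
        moreover have "13 / 5 * sqrt (real n) * J\<^sup>2 =
            13 / 10 * ((sqrt (real n) * \<sigma>\<^sup>2) * (D + P)) / D\<^sup>2"
          unfolding J2 by simp
        ultimately have "13 / 5 * sqrt (real n) * J\<^sup>2 = 13 / 10 * (\<sigma> * D + \<sigma> * P) / D\<^sup>2"
          by (simp only: distrib_left)
        also have "\<dots> \<le> (1087 / 1000)\<^sup>2"
          unfolding D_def P_def
        proof (rule cauchy_mean_estimate[OF \<sigma>(1)])
          show "\<sigma>\<^sup>2 \<le> 1 / 3" unfolding \<sigma>(2) using 3 by (simp add: field_simps)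
        qed
        finally have "fact n * (13 / 5 * sqrt (real n) * J\<^sup>2) \<le> fact n * (1087 / 1000)\<^sup>2"
          by (rule mult_left_mono) simp
        thus ?thesis by (simp only: mult.assoc)
      qed
      finally show ?thesis .
    qed
  qed
  also have "(hermite_prob n y)\<^sup>2 * exp (- y\<^sup>2 / 2) = (\<bar>hermite_prob n y\<bar> * exp (- y\<^sup>2 / 4))\<^sup>2"
    by (simp add: power_mult_distrib flip: exp_of_nat_mult)
  also have "fact n * (1087 / 1000)\<^sup>2 = (1087 / 1000 * sqrt (fact n))\<^sup>2"
    by (simp add: power_mult_distrib power_divide)
  finally show ?thesis by (rule power2_le_imp_le) simp
qed

section \<open>Hermite polynomials and the Gaussian measure\<close>

abbreviation gaussian :: "real measure" where
  "gaussian \<equiv> density lborel std_normal_density"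

interpretation gaussian: prob_space gaussian
  by (rule prob_space_normal_density) simp

lemma integral_gaussian:
  assumes "f \<in> borel_measurable borel"
  shows "(\<integral>x. f x \<partial>gaussian) = (\<integral>x. std_normal_density x * f x \<partial>lborel)"
  using assms by (subst integral_density) auto

lemma integrable_gaussian_iff:
  fixes f :: "real \<Rightarrow> real"
  assumes "f \<in> borel_measurable borel"
  shows "integrable gaussian f \<longleftrightarrow> integrable lborel (\<lambda>x. std_normal_density x * f x)"
  using assms by (subst integrable_density) auto

lemma integrable_gaussian_power: "integrable gaussian (\<lambda>x. x ^ k)"
  by (simp add: integrable_gaussian_iff integrable_std_normal_moment)

lemma integrable_gaussian_poly: "integrable gaussian (poly p)"
  unfolding poly_altdef by (intro Bochner_Integration.integrable_sum integrable_mult_right integrable_gaussian_power)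

text \<open>Integration by parts for monomials, read off the known moments. For k = 0 the truncated
  exponent \<open>k - 1\<close> is harmless because the prefactor vanishes.\<close>

lemma gaussian_moment_Suc:
  "(\<integral>x. x ^ Suc k \<partial>gaussian) = real k * (\<integral>x. x ^ (k - 1) \<partial>gaussian)"
proof (cases "even k")
  case True
  then obtain m where k: "k = 2 * m" by blast
  have odd: "(\<integral>x. x ^ (2 * i + 1) \<partial>gaussian) = 0" for i
    using integral_std_normal_moment_odd[of i] by (simp add: integral_gaussian)
  show ?thesis
  proof (cases m)
    case 0
    thus ?thesis using odd[of 0] by (simp add: k)
  next
    case (Suc i)
    thus ?thesis using odd[of m] odd[of i] by (simp add: k)
  qed
next
  case False
  then obtain m where k: "k = 2 * m + 1" by (meson oddE)
  have even: "(\<integral>x. x ^ (2 * i) \<partial>gaussian) = fact (2 * i) / (2 ^ i * fact i)" for i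
    using integral_std_normal_moment_even[of i] by (simp add: integral_gaussian)
  have "(\<integral>x. x ^ Suc k \<partial>gaussian) = fact (2 * Suc m) / (2 ^ Suc m * fact (Suc m))"
    using even[of "Suc m"] by (simp add: k)
  also have "fact (2 * Suc m) = (2 * real m + 2) * ((2 * real m + 1) * fact (2 * m) :: real)"
    by (simp add: algebra_simps)
  also have "\<dots> / (2 ^ Suc m * fact (Suc m)) = real k * (fact (2 * m) / (2 ^ m * fact m))"
    by (simp add: k divide_simps) (simp add: algebra_simps)
  also have "\<dots> = real k * (\<integral>x. x ^ (k - 1) \<partial>gaussian)" using even[of m] by (simp add: k)
  finally show ?thesis .
qed

text \<open>Stein's identity. Linearity reduces it to the moment recursion, so no boundary terms
  arise.\<close>

lemma gaussian_integration_by_parts_poly: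
  "(\<integral>x. x * poly p x \<partial>gaussian) = (\<integral>x. poly (pderiv p) x \<partial>gaussian)"
proof -
  have *: "(\<integral>x. x * poly (\<Sum>i\<in>A. monom (c i) i) x \<partial>gaussian) =
      (\<integral>x. poly (pderiv (\<Sum>i\<in>A. monom (c i) i)) x \<partial>gaussian)" if "finite A" for A c
    using that
  proof (induction A)
    case (insert a A)
    let ?q = "\<Sum>i\<in>A. monom (c i) i"
    have int: "integrable gaussian (\<lambda>x. x * poly p x)" for p
      by (rule Bochner_Integration.integrable_cong[THEN iffD1,
            OF refl _ integrable_gaussian_poly[of "[:0, 1:] * p"]]) simp
    have "(\<integral>x. x * poly (monom (c a) a) x \<partial>gaussian) = c a * (\<integral>x. x ^ Suc a \<partial>gaussian)"
      unfolding integral_mult_right_zero[symmetric] by (simp add: poly_monom mult_ac)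
    also have "\<dots> = (\<integral>x. poly (pderiv (monom (c a) a)) x \<partial>gaussian)"
      by (simp only: gaussian_moment_Suc) (simp add: pderiv_monom poly_monom)
    finally show ?case
      using insert int[of "monom (c a) a"] int[of ?q]
      by (simp add: pderiv_add distrib_left integrable_gaussian_poly Bochner_Integration.integral_add)
  qed simp
  show ?thesis using *[of "{..degree p}" "coeff p"] by (simp add: poly_as_sum_of_monoms)
qed

text \<open>Under the Gaussian measure the adjoint of differentiation is q -> x q - q', which is
  exactly the recursion that defines the Hermite polynomials.\<close>

lemma gaussian_integral_hermite_poly_mult:
  "(\<integral>x. poly (hermite_poly (Suc n) * q) x \<partial>gaussian) = (\<integral>x. poly (hermite_poly n * pderiv q) x \<partial>gaussian)"
proof -
  let ?h = "hermite_poly n"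
  have "(\<integral>x. poly (hermite_poly (Suc n) * q) x \<partial>gaussian) =
      (\<integral>x. poly ([:0, 1:] * (?h * q)) x - poly (pderiv ?h * q) x \<partial>gaussian)"
    by (rule Bochner_Integration.integral_cong) (simp_all add: algebra_simps)
  also have "\<dots> = (\<integral>x. poly ([:0, 1:] * (?h * q)) x \<partial>gaussian) - (\<integral>x. poly (pderiv ?h * q) x \<partial>gaussian)"
    by (intro Bochner_Integration.integral_diff integrable_gaussian_poly)
  also have "(\<integral>x. poly ([:0, 1:] * (?h * q)) x \<partial>gaussian) = (\<integral>x. x * poly (?h * q) x \<partial>gaussian)"
    by simp
  also have "\<dots> = (\<integral>x. poly (?h * pderiv q) x + poly (pderiv ?h * q) x \<partial>gaussian)"
    unfolding gaussian_integration_by_parts_poly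
    by (rule Bochner_Integration.integral_cong) (simp_all add: pderiv_mult algebra_simps)
  also have "\<dots> = (\<integral>x. poly (?h * pderiv q) x \<partial>gaussian) + (\<integral>x. poly (pderiv ?h * q) x \<partial>gaussian)"
    by (intro Bochner_Integration.integral_add integrable_gaussian_poly)
  finally show ?thesis by simp
qed

lemma gaussian_integral_hermite_poly_square:
  "(\<integral>x. (poly (hermite_poly n) x)\<^sup>2 \<partial>gaussian) = fact n"
proof (induction n)
  case 0
  show ?case using gaussian.prob_space by simp
next
  case (Suc n)
  have "(\<integral>x. (poly (hermite_poly (Suc n)) x)\<^sup>2 \<partial>gaussian) =
      (\<integral>x. poly (hermite_poly (Suc n) * hermite_poly (Suc n)) x \<partial>gaussian)"
    by (simp only: poly_mult power2_eq_square)
  also have "\<dots> = (\<integral>x. real (Suc n) * (poly (hermite_poly n) x)\<^sup>2 \<partial>gaussian)"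
    unfolding gaussian_integral_hermite_poly_mult pderiv_hermite_poly_Suc
    by (rule Bochner_Integration.integral_cong) (simp_all add: power2_eq_square)
  also have "\<dots> = fact (Suc n)" by (simp add: Suc.IH)
  finally show ?case .
qed

lemma borel_measurable_hermite_prob [measurable]: "hermite_prob n \<in> borel_measurable borel"
  unfolding hermite_prob_eq_poly[abs_def]
  by (intro borel_measurable_continuous_onI continuous_intros)

text \<open>\<open>h\<close> is the square of an eigenfunction. Its exponential turns the weight
  exp(- x^2 / 2) into exp(- (\<beta> x)^2 / 2), so substituting y = \<beta> x reduces the claim to
  the norm of a Hermite polynomial; the factor \<beta> cancels the Jacobian.\<close>

lemma gaussian_rescaled_hermite_square:
  fixes n :: nat
  assumes "0 < \<beta>"
  defines "h \<equiv> \<lambda>x. \<beta> / fact n * exp (- (\<beta>\<^sup>2 - 1) / 2 * x\<^sup>2) * (hermite_prob n (\<beta> * x))\<^sup>2"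
  shows "integrable gaussian h" and "(\<integral>x. h x \<partial>gaussian) = 1"
proof -
  define g where "g = (\<lambda>x. std_normal_density x * (hermite_prob n x)\<^sup>2)"
  have [measurable]: "h \<in> borel_measurable borel" unfolding h_def by measurable
  have "integrable gaussian (\<lambda>x. (hermite_prob n x)\<^sup>2)"
    by (rule Bochner_Integration.integrable_cong[THEN iffD1,
          OF refl _ integrable_gaussian_poly[of "hermite_poly n * hermite_poly n"]])
      (simp add: hermite_prob_eq_poly power2_eq_square)
  hence g: "integrable lborel g"
    unfolding g_def by (subst (asm) integrable_gaussian_iff) measurable
  have "(\<integral>x. (hermite_prob n x)\<^sup>2 \<partial>gaussian) = fact n"
    unfolding hermite_prob_eq_poly by (rule gaussian_integral_hermite_poly_square)
  hence int_g: "(\<integral>x. g x \<partial>lborel) = fact n"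
    unfolding g_def by (subst (asm) integral_gaussian) measurable
  have gh: "std_normal_density x * h x = \<beta> / fact n * g (0 + \<beta> * x)" for x
  proof -
    have "std_normal_density x * h x = \<beta> / fact n * (1 / sqrt (2 * pi) *
        (exp (- x\<^sup>2 / 2) * exp (- (\<beta>\<^sup>2 - 1) / 2 * x\<^sup>2)) * (hermite_prob n (\<beta> * x))\<^sup>2)"
      by (simp only: h_def std_normal_density_def mult_ac)
    also have "exp (- x\<^sup>2 / 2) * exp (- (\<beta>\<^sup>2 - 1) / 2 * x\<^sup>2) = exp (- (\<beta> * x)\<^sup>2 / 2)"
      unfolding exp_add[symmetric] by (simp add: field_simps power2_eq_square)
    finally show ?thesis by (simp only: g_def std_normal_density_def add_0)
  qed
  have "integrable lborel (\<lambda>x. g (0 + \<beta> * x))"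
    by (rule lborel_integrable_real_affine[OF g]) (use assms(1) in simp)
  thus "integrable gaussian h"
    by (simp only: integrable_gaussian_iff \<open>h \<in> borel_measurable borel\<close> gh) (rule integrable_mult_right)
  have "(\<integral>x. h x \<partial>gaussian) = \<beta> / fact n * (\<integral>x. g (0 + \<beta> * x) \<partial>lborel)"
    by (subst integral_gaussian) (simp_all only: gh \<open>h \<in> borel_measurable borel\<close> integral_mult_right_zero)
  also have "\<dots> = 1 / fact n * (\<integral>x. g x \<partial>lborel)"
    using lborel_integral_real_affine[of \<beta> g 0] assms(1) by simp
  finally show "(\<integral>x. h x \<partial>gaussian) = 1" by (simp add: int_g)
qed

section \<open>Error functionals on a reproducing kernel Hilbert space\<close>

lemma (in rkhs) ip_square_le:
  assumes "f \<in> H" "v \<in> H" "ip f f \<le> 1"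
  shows "(ip f v)\<^sup>2 \<le> ip v v"
proof -
  define t where "t = ip f v"
  let ?u = "\<lambda>x. v x + (- t) * f x"
  have tf: "(\<lambda>x. (- t) * f x) \<in> H" using assms scale_mem by blast
  have u: "?u \<in> H" using add_mem[OF assms(2) tf] .
  have "ip ?u ?u = ip v ?u + (- t) * ip f ?u"
    by (simp only: ip_add_left[OF assms(2) tf u] ip_scale_left[OF assms(1) u])
  also have "ip v ?u = ip v v + (- t) * ip f v"
    by (simp only: ip_commute[OF assms(2) u] ip_add_left[OF assms(2) tf assms(2)]
        ip_scale_left[OF assms(1,2)])
  also have "ip f ?u = ip f v + (- t) * ip f f"
    by (simp only: ip_commute[OF assms(1) u] ip_add_left[OF assms(2) tf assms(1)]
        ip_scale_left[OF assms(1,1)] ip_commute[OF assms(2,1)])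
  finally have "ip ?u ?u = ip v v - 2 * t\<^sup>2 + t\<^sup>2 * ip f f"
    by (simp add: t_def[symmetric] power2_eq_square algebra_simps)
  moreover have "t\<^sup>2 * ip f f \<le> t\<^sup>2 * 1" by (rule mult_left_mono[OF assms(3)]) simp
  ultimately show ?thesis using ip_nonneg[OF u] by (simp add: t_def)
qed

text \<open>
  This is the Cauchy--Schwarz inequality for \<open>v + s (k p\<^sub>1 + \<dots> + k p\<^sub>j)\<close>, averaged over independent
  points \<open>p\<^sub>i\<close> distributed as \<open>M\<close>; the induction integrates out one point at a time, so that no
  product measure and no vector-valued integral is needed.
\<close>

lemma (in rkhs) mean_functional_bound_copies:
  assumes M: "prob_space M"
    and int: "\<And>h. h \<in> H \<Longrightarrow> integrable M h"
    and int_diag: "integrable M (\<lambda>p. k p p)"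
    and int_mean: "integrable M (\<lambda>p. \<integral>y. k y p \<partial>M)"
    and f: "f \<in> H" "ip f f \<le> 1"
    and v: "v \<in> H"
  shows "(ip f v + real j * s * (\<integral>y. f y \<partial>M))\<^sup>2 \<le> ip v v + 2 * real j * s * (\<integral>y. v y \<partial>M) +
    s\<^sup>2 * (real j * (\<integral>p. k p p \<partial>M) + real j * (real j - 1) * (\<integral>p. \<integral>y. k y p \<partial>M \<partial>M))"
  using v
proof (induction j arbitrary: v)
  case 0
  show ?case using ip_square_le[OF f(1) 0 f(2)] by simp
next
  case (Suc j)
  interpret prob_space M by fact
  define g where "g = (\<lambda>p. \<integral>y. k y p \<partial>M)"
  define \<kappa> where "\<kappa> = (\<integral>p. k p p \<partial>M)"
  define G where "G = (\<integral>p. g p \<partial>M)"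
  define F where "F = (\<integral>y. f y \<partial>M)"
  define V where "V = (\<integral>y. v y \<partial>M)"
  \<comment> \<open>The mean of the quantity to be squared. The tangent bound 2 m X - m^2 \<le> X^2
    plays the role of Jensen's inequality and keeps the integrand affine in \<open>f p\<close>, so
    integrability of \<open>f\<close> suffices.\<close>
  define m where "m = ip f v + real (Suc j) * s * F"
  have "2 * m * (ip f v + s * f p + real j * s * F) - m\<^sup>2 \<le>
      ip v v + 2 * s * v p + s\<^sup>2 * k p p + 2 * real j * s * (V + s * g p) +
      s\<^sup>2 * (real j * \<kappa> + real j * (real j - 1) * G)" for p
  proof -
    let ?k = "\<lambda>y. s * k y p"
    let ?u = "\<lambda>y. v y + s * k y p"
    note kp = kernel_mem[of p]
    have sk: "?k \<in> H" by (rule scale_mem[OF kp])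
    have u: "?u \<in> H" by (rule add_mem[OF Suc.prems sk])
    have fu: "ip f ?u = ip f v + s * f p"
      by (simp only: ip_commute[OF f(1) u] ip_add_left[OF Suc.prems sk f(1)] ip_scale_left[OF kp f(1)]
          ip_commute[OF kp f(1)] reproducing[OF f(1)] ip_commute[OF Suc.prems f(1)])
    have uk: "ip ?u (\<lambda>y. k y p) = v p + s * k p p" by (rule reproducing[OF u])
    have vu: "ip v ?u = ip v v + s * v p"
      by (simp only: ip_commute[OF Suc.prems u] ip_add_left[OF Suc.prems sk Suc.prems]
          ip_scale_left[OF kp Suc.prems] ip_commute[OF kp Suc.prems] reproducing[OF Suc.prems])
    have "ip ?u ?u = ip v v + s * v p + s * (v p + s * k p p)"
      by (simp only: ip_add_left[OF Suc.prems sk u] ip_scale_left[OF kp u] ip_commute[OF kp u] uk vu)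
    hence uu: "ip ?u ?u = ip v v + 2 * s * v p + s\<^sup>2 * k p p"
      by (simp add: power2_eq_square algebra_simps)
    have mean_u: "(\<integral>y. v y + s * k y p \<partial>M) = V + s * g p"
      by (simp add: V_def g_def int Suc.prems kp)
    have "0 \<le> (m - (ip f v + s * f p + real j * s * F))\<^sup>2" by simp
    hence "2 * m * (ip f v + s * f p + real j * s * F) - m\<^sup>2 \<le> (ip f v + s * f p + real j * s * F)\<^sup>2"
      by (simp add: power2_eq_square algebra_simps)
    also have "\<dots> \<le> ip v v + 2 * s * v p + s\<^sup>2 * k p p + 2 * real j * s * (V + s * g p) +
      s\<^sup>2 * (real j * \<kappa> + real j * (real j - 1) * G)"
      using Suc.IH[OF u] unfolding fu uu mean_u by (simp only: F_def \<kappa>_def G_def g_def)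
    finally show ?thesis .
  qed
  hence "(\<integral>p. 2 * m * (ip f v + s * f p + real j * s * F) - m\<^sup>2 \<partial>M) \<le>
      (\<integral>p. ip v v + 2 * s * v p + s\<^sup>2 * k p p + 2 * real j * s * (V + s * g p) +
      s\<^sup>2 * (real j * \<kappa> + real j * (real j - 1) * G) \<partial>M)"
    using int[OF f(1)] int[OF Suc.prems] int_diag int_mean
    by (intro integral_mono) (auto simp: g_def)
  also have "(\<integral>p. 2 * m * (ip f v + s * f p + real j * s * F) - m\<^sup>2 \<partial>M) =
      2 * m * (ip f v + s * F + real j * s * F) - m\<^sup>2"
    using int[OF f(1)] by (simp add: prob_space F_def)
  also have "\<dots> = m\<^sup>2" by (simp add: m_def power2_eq_square algebra_simps)
  also have "(\<integral>p. ip v v + 2 * s * v p + s\<^sup>2 * k p p + 2 * real j * s * (V + s * g p) +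
      s\<^sup>2 * (real j * \<kappa> + real j * (real j - 1) * G) \<partial>M) =
      ip v v + 2 * s * V + s\<^sup>2 * \<kappa> + 2 * real j * s * (V + s * G) +
      s\<^sup>2 * (real j * \<kappa> + real j * (real j - 1) * G)"
    using int[OF Suc.prems] int_diag int_mean by (simp add: prob_space V_def \<kappa>_def G_def g_def)
  also have "\<dots> = ip v v + 2 * real (Suc j) * s * V +
      s\<^sup>2 * (real (Suc j) * \<kappa> + real (Suc j) * (real (Suc j) - 1) * G)"
    by (simp add: power2_eq_square algebra_simps)
  finally show ?case by (simp only: m_def F_def V_def \<kappa>_def G_def g_def)
qed

text \<open>Taking s as the inverse of the number of points gives an average whose diagonal excess
  \<kappa> - G is divided by that number and vanishes in the limit. The result is formally
  Cauchy-Schwarz for v plus the mean embedding, which is never built as an element of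
  \<open>H\<close>.\<close>

lemma (in rkhs) mean_functional_bound:
  assumes M: "prob_space M"
    and int: "\<And>h. h \<in> H \<Longrightarrow> integrable M h"
    and int_diag: "integrable M (\<lambda>p. k p p)"
    and int_mean: "integrable M (\<lambda>p. \<integral>y. k y p \<partial>M)"
    and f: "f \<in> H" "ip f f \<le> 1"
    and v: "v \<in> H"
  shows "(ip f v + (\<integral>y. f y \<partial>M))\<^sup>2 \<le>
    ip v v + 2 * (\<integral>y. v y \<partial>M) + (\<integral>p. \<integral>y. k y p \<partial>M \<partial>M)"
proof -
  define \<kappa> where "\<kappa> = (\<integral>p. k p p \<partial>M)"
  define G where "G = (\<integral>p. \<integral>y. k y p \<partial>M \<partial>M)"
  have "(ip f v + (\<integral>y. f y \<partial>M))\<^sup>2 \<le>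
      ip v v + 2 * (\<integral>y. v y \<partial>M) + G + (\<kappa> - G) * inverse (real (Suc j))" for j
  proof -
    have s: "real (Suc j) * inverse (real (Suc j)) = 1" by simp
    have "(inverse (real (Suc j)))\<^sup>2 * (real (Suc j) * \<kappa> + real (Suc j) * (real (Suc j) - 1) * G) =
       (inverse (real (Suc j))) * (\<kappa> + (real (Suc j) - 1) * G)"
      by (simp add: power2_eq_square field_simps del: of_nat_Suc)
    also have "\<dots> = G + (\<kappa> - G) * inverse (real (Suc j))"
      by (simp add: field_simps)
    finally show ?thesis
      using mean_functional_bound_copies[OF assms, of "Suc j" "inverse (real (Suc j))"]
      unfolding \<kappa>_def[symmetric] G_def[symmetric] mult.assoc[of 2] s by (simp only: mult_1 mult_1_right add.assoc)
  qed
  moreover have "(\<lambda>j. ip v v + 2 * (\<integral>y. v y \<partial>M) + G + (\<kappa> - G) * inverse (real (Suc j))) \<longlonglongrightarrow>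
      ip v v + 2 * (\<integral>y. v y \<partial>M) + G + (\<kappa> - G) * 0"
    by (intro tendsto_intros LIMSEQ_inverse_real_of_nat)
  ultimately show ?thesis unfolding G_def by (auto intro: LIMSEQ_le_const)
qed

lemma (in rkhs) kernel_combination:
  assumes "finite I"
  shows "(\<lambda>y. \<Sum>i\<in>I. c i * k y (x i)) \<in> H"
    and "h \<in> H \<Longrightarrow> ip h (\<lambda>y. \<Sum>i\<in>I. c i * k y (x i)) = (\<Sum>i\<in>I. c i * h (x i))"
proof -
  have "(\<lambda>y. \<Sum>i\<in>I. c i * k y (x i)) \<in> H \<and>
    (\<forall>h\<in>H. ip h (\<lambda>y. \<Sum>i\<in>I. c i * k y (x i)) = (\<Sum>i\<in>I. c i * h (x i)))"
    using assms
  proof (induction I)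
    case empty
    have "ip h (\<lambda>x. 0) = 0" if "h \<in> H" for h
      using ip_scale_left[OF zero_mem that, of 0] ip_commute[OF that zero_mem] by simp
    thus ?case using zero_mem by simp
  next
    case (insert a I)
    let ?k = "\<lambda>y. c a * k y (x a)" and ?v = "\<lambda>y. \<Sum>i\<in>I. c i * k y (x i)"
    have k: "?k \<in> H" by (rule scale_mem[OF kernel_mem])
    have v: "?v \<in> H" using insert.IH by blast
    have "ip h (\<lambda>y. ?k y + ?v y) = c a * h (x a) + (\<Sum>i\<in>I. c i * h (x i))" if "h \<in> H" for h
    proof -
      have "ip h (\<lambda>y. ?k y + ?v y) = ip ?k h + ip ?v h"
        using ip_commute[OF that add_mem[OF k v]] ip_add_left[OF k v that] by simp
      also have "ip ?k h = c a * h (x a)"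
        using ip_scale_left[OF kernel_mem that] ip_commute[OF kernel_mem that] reproducing[OF that]
        by simp
      also have "ip ?v h = (\<Sum>i\<in>I. c i * h (x i))"
        using insert.IH ip_commute[OF v that] that by simp
      finally show ?thesis .
    qed
    thus ?case using insert.hyps add_mem[OF k v] by simp
  qed
  thus "(\<lambda>y. \<Sum>i\<in>I. c i * k y (x i)) \<in> H"
    and "h \<in> H \<Longrightarrow> ip h (\<lambda>y. \<Sum>i\<in>I. c i * k y (x i)) = (\<Sum>i\<in>I. c i * h (x i))" by blast+
qed

text \<open>For v the kernel combination with weights - w, the three terms of
  \<open>mean_functional_bound\<close> expand into \<open>a n * (q n)^2\<close>,
  \<open>2 * a n * m n * q n\<close> and \<open>a n * (m n)^2\<close>, which form a square. Sums and
  integrals are exchanged under the majorant \<open>sqrt (a n)\<close>.\<close>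

lemma (in rkhs) quadrature_error_mercer:
  fixes \<phi> :: "nat \<Rightarrow> 'a \<Rightarrow> real" and a :: "nat \<Rightarrow> real"
  assumes M: "prob_space M"
    and int: "\<And>h. h \<in> H \<Longrightarrow> integrable M h"
    and a: "\<And>n. 0 \<le> a n" "summable (\<lambda>n. sqrt (a n))"
    and mercer: "\<And>x y. (\<lambda>n. a n * \<phi> n x * \<phi> n y) sums k x y"
    and diag: "\<And>x. k x x = 1"
    and \<phi>: "\<And>n. integrable M (\<phi> n)" "\<And>n. (\<integral>x. \<bar>\<phi> n x\<bar> \<partial>M) \<le> 1"
    and f: "f \<in> H" "ip f f \<le> 1"
    and I: "finite I"
  shows "summable (\<lambda>n. a n * ((\<integral>y. \<phi> n y \<partial>M) - (\<Sum>i\<in>I. w i * \<phi> n (x i)))\<^sup>2)"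
    and "((\<integral>y. f y \<partial>M) - (\<Sum>i\<in>I. w i * f (x i)))\<^sup>2 \<le>
      (\<Sum>n. a n * ((\<integral>y. \<phi> n y \<partial>M) - (\<Sum>i\<in>I. w i * \<phi> n (x i)))\<^sup>2)"
proof -
  interpret prob_space M by fact
  define m where "m = (\<lambda>n. \<integral>y. \<phi> n y \<partial>M)"
  have m: "\<bar>m n\<bar> \<le> 1" for n
    unfolding m_def by (rule order.trans[OF integral_abs_bound \<phi>(2)])
  \<comment> \<open>The diagonal series has nonnegative terms and sum one, so no term exceeds one;
    this yields the majorant without any pointwise estimate of \<phi>.\<close>
  have bound: "sqrt (a n) * \<bar>\<phi> n y\<bar> \<le> 1" for n y
  proof (rule power2_le_imp_le)
    have "(\<Sum>j\<in>{n}. a j * \<phi> j y * \<phi> j y) \<le> (\<Sum>j. a j * \<phi> j y * \<phi> j y)"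
      by (rule sum_le_suminf) (use sums_summable[OF mercer] a(1) in \<open>auto simp: mult.assoc\<close>)
    hence "a n * (\<phi> n y)\<^sup>2 \<le> 1"
      using sums_unique[OF mercer[of y y]] diag[of y] by (simp add: power2_eq_square mult.assoc)
    thus "(sqrt (a n) * \<bar>\<phi> n y\<bar>)\<^sup>2 \<le> 1\<^sup>2"
      using a(1)[of n] by (simp add: power_mult_distrib)
  qed simp
  have bound1: "\<bar>a n * \<phi> n y\<bar> \<le> sqrt (a n)" for n y
  proof -
    have "\<bar>a n * \<phi> n y\<bar> = sqrt (a n) * (sqrt (a n) * \<bar>\<phi> n y\<bar>)"
      using a(1)[of n] by (simp add: abs_mult)
    also have "\<dots> \<le> sqrt (a n) * 1" by (intro mult_left_mono bound) (use a in auto)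
    finally show ?thesis by simp
  qed
  have mean: "(\<lambda>n. a n * m n * \<phi> n y) sums (\<integral>p. k p y \<partial>M)" for y
  proof -
    have "(\<lambda>n. \<integral>p. a n * \<phi> n p * \<phi> n y \<partial>M) sums (\<integral>p. (\<Sum>n. a n * \<phi> n p * \<phi> n y) \<partial>M)"
    proof (rule sums_integral)
      show "integrable M (\<lambda>p. a n * \<phi> n p * \<phi> n y)" for n using \<phi>(1) by simp
      have "summable (\<lambda>n. norm (a n * \<phi> n p * \<phi> n y))" for p
      proof (rule summable_comparison_test')
        show "summable (\<lambda>n. a n * \<phi> n p * \<phi> n p + a n * \<phi> n y * \<phi> n y)"
          by (intro summable_add sums_summable[OF mercer])
        fix n
        have "2 * \<bar>\<phi> n p * \<phi> n y\<bar> \<le> \<phi> n p * \<phi> n p + \<phi> n y * \<phi> n y"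
          using sum_squares_bound[of "\<bar>\<phi> n p\<bar>" "\<bar>\<phi> n y\<bar>"] by (simp add: abs_mult power2_eq_square)
        moreover have "0 \<le> \<bar>\<phi> n p * \<phi> n y\<bar>" by simp
        ultimately have "\<bar>\<phi> n p * \<phi> n y\<bar> \<le> \<phi> n p * \<phi> n p + \<phi> n y * \<phi> n y" by linarith
        hence "a n * \<bar>\<phi> n p * \<phi> n y\<bar> \<le> a n * (\<phi> n p * \<phi> n p + \<phi> n y * \<phi> n y)"
          by (rule mult_left_mono) (rule a)
        thus "norm (norm (a n * \<phi> n p * \<phi> n y)) \<le> a n * \<phi> n p * \<phi> n p + a n * \<phi> n y * \<phi> n y"
          using a(1)[of n] by (simp add: abs_mult algebra_simps)
      qed
      thus "AE p in M. summable (\<lambda>n. norm (a n * \<phi> n p * \<phi> n y))" by simp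
      show "summable (\<lambda>n. \<integral>p. norm (a n * \<phi> n p * \<phi> n y) \<partial>M)"
      proof (rule summable_comparison_test'[OF a(2)])
        fix n
        have "(\<integral>p. norm (a n * \<phi> n p * \<phi> n y) \<partial>M) = (\<integral>p. \<bar>a n * \<phi> n y\<bar> * \<bar>\<phi> n p\<bar> \<partial>M)"
          by (simp add: abs_mult mult_ac)
        also have "\<dots> = \<bar>a n * \<phi> n y\<bar> * (\<integral>p. \<bar>\<phi> n p\<bar> \<partial>M)" by simp
        also have "\<dots> \<le> sqrt (a n) * 1" by (intro mult_mono bound1 \<phi>(2)) (use a in auto)
        finally show "norm (\<integral>p. norm (a n * \<phi> n p * \<phi> n y) \<partial>M) \<le> sqrt (a n)" by simp
      qed
    qed
    moreover have "(\<integral>p. a n * \<phi> n p * \<phi> n y \<partial>M) = a n * m n * \<phi> n y" for n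
      by (simp add: m_def)
    ultimately have "(\<lambda>n. a n * m n * \<phi> n y) sums (\<integral>p. (\<Sum>n. a n * \<phi> n p * \<phi> n y) \<partial>M)"
      by (simp only:)
    thus ?thesis by (simp only: sums_unique[OF mercer, symmetric])
  qed
  have int_terms: "integrable M (\<lambda>y. a n * m n * \<phi> n y)" for n using \<phi>(1) by simp
  have bound2: "norm (a n * m n * \<phi> n y) \<le> sqrt (a n)" for n y
  proof -
    have "norm (a n * m n * \<phi> n y) = \<bar>m n\<bar> * \<bar>a n * \<phi> n y\<bar>" by (simp add: abs_mult)
    also have "\<dots> \<le> 1 * sqrt (a n)" by (intro mult_mono m bound1) auto
    finally show ?thesis by simp
  qed
  have summable_terms: "AE y in M. summable (\<lambda>n. norm (a n * m n * \<phi> n y))"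
    by (intro AE_I2 summable_comparison_test'[OF a(2)]) (use bound2 in simp)
  have summable_int: "summable (\<lambda>n. \<integral>y. norm (a n * m n * \<phi> n y) \<partial>M)"
  proof (rule summable_comparison_test'[OF a(2)])
    fix n
    have "(\<integral>y. norm (a n * m n * \<phi> n y) \<partial>M) \<le> (\<integral>y. sqrt (a n) \<partial>M)"
      by (intro integral_mono integrable_norm int_terms bound2) auto
    thus "norm (\<integral>y. norm (a n * m n * \<phi> n y) \<partial>M) \<le> sqrt (a n)" by (simp add: prob_space)
  qed
  have mean_eq: "(\<integral>p. k p y \<partial>M) = (\<Sum>n. a n * m n * \<phi> n y)" for y
    using mean by (rule sums_unique)
  have int_mean: "integrable M (\<lambda>y. \<integral>p. k p y \<partial>M)"
    unfolding mean_eq by (rule integrable_suminf[OF int_terms summable_terms summable_int])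
  have "(\<lambda>n. \<integral>y. a n * m n * \<phi> n y \<partial>M) sums (\<integral>y. (\<Sum>n. a n * m n * \<phi> n y) \<partial>M)"
    by (rule sums_integral[OF int_terms summable_terms summable_int])
  moreover have "(\<integral>y. a n * m n * \<phi> n y \<partial>M) = a n * (m n)\<^sup>2" for n
    by (simp add: m_def power2_eq_square)
  ultimately have double_mean: "(\<lambda>n. a n * (m n)\<^sup>2) sums (\<integral>y. \<integral>p. k p y \<partial>M \<partial>M)"
    unfolding mean_eq by (simp only:)
  have int_diag: "integrable M (\<lambda>p. k p p)" unfolding diag by simp
  define c where "c = (\<lambda>i. - w i)"
  define v where "v = (\<lambda>y. \<Sum>i\<in>I. c i * k y (x i))"
  define q where "q = (\<lambda>n. \<Sum>i\<in>I. c i * \<phi> n (x i))"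
  have v: "v \<in> H" unfolding v_def by (rule kernel_combination(1)[OF I])
  have ip_v: "ip h v = (\<Sum>i\<in>I. c i * h (x i))" if "h \<in> H" for h
    unfolding v_def by (rule kernel_combination(2)[OF I that])
  have "(\<lambda>n. \<Sum>j\<in>I. c j * (\<Sum>i\<in>I. c i * (a n * \<phi> n (x j) * \<phi> n (x i)))) sums ip v v"
    unfolding ip_v[OF v] unfolding v_def by (intro sums_sum sums_mult mercer)
  moreover have "(\<Sum>j\<in>I. c j * (\<Sum>i\<in>I. c i * (a n * \<phi> n (x j) * \<phi> n (x i)))) = a n * (q n)\<^sup>2" for n
    by (simp add: q_def power2_eq_square sum_product sum_distrib_left mult_ac)
  ultimately have ip_vv: "(\<lambda>n. a n * (q n)\<^sup>2) sums ip v v" by simp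
  have "(\<integral>y. v y \<partial>M) = (\<Sum>i\<in>I. c i * (\<integral>y. k y (x i) \<partial>M))"
    unfolding v_def using int[OF kernel_mem] by simp
  moreover have "(\<lambda>n. \<Sum>i\<in>I. c i * (a n * m n * \<phi> n (x i))) sums (\<Sum>i\<in>I. c i * (\<integral>y. k y (x i) \<partial>M))"
    by (intro sums_sum sums_mult mean)
  moreover have "(\<Sum>i\<in>I. c i * (a n * m n * \<phi> n (x i))) = a n * m n * q n" for n
    by (simp add: q_def sum_distrib_left mult_ac)
  ultimately have mean_v: "(\<lambda>n. a n * m n * q n) sums (\<integral>y. v y \<partial>M)" by simp
  have "(\<lambda>n. a n * (q n)\<^sup>2 + 2 * (a n * m n * q n) + a n * (m n)\<^sup>2) sums
      (ip v v + 2 * (\<integral>y. v y \<partial>M) + (\<integral>y. \<integral>p. k p y \<partial>M \<partial>M))"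
    by (intro sums_add sums_mult ip_vv mean_v double_mean)
  moreover have "a n * (q n)\<^sup>2 + 2 * (a n * m n * q n) + a n * (m n)\<^sup>2 =
      a n * ((\<integral>y. \<phi> n y \<partial>M) - (\<Sum>i\<in>I. w i * \<phi> n (x i)))\<^sup>2" for n
  proof -
    have "(\<integral>y. \<phi> n y \<partial>M) - (\<Sum>i\<in>I. w i * \<phi> n (x i)) = m n + q n"
      by (simp add: m_def q_def c_def sum_negf)
    thus ?thesis by (simp add: power2_eq_square algebra_simps)
  qed
  ultimately have total: "(\<lambda>n. a n * ((\<integral>y. \<phi> n y \<partial>M) - (\<Sum>i\<in>I. w i * \<phi> n (x i)))\<^sup>2) sums
      (ip v v + 2 * (\<integral>y. v y \<partial>M) + (\<integral>y. \<integral>p. k p y \<partial>M \<partial>M))" by simp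
  thus "summable (\<lambda>n. a n * ((\<integral>y. \<phi> n y \<partial>M) - (\<Sum>i\<in>I. w i * \<phi> n (x i)))\<^sup>2)"
    by (rule sums_summable)
  have "((\<integral>y. f y \<partial>M) - (\<Sum>i\<in>I. w i * f (x i)))\<^sup>2 = (ip f v + (\<integral>y. f y \<partial>M))\<^sup>2"
    unfolding ip_v[OF f(1)] by (simp add: c_def sum_negf)
  also have "\<dots> \<le> ip v v + 2 * (\<integral>y. v y \<partial>M) + (\<integral>y. \<integral>p. k p y \<partial>M \<partial>M)"
    by (rule mean_functional_bound[OF M int int_diag int_mean f v])
  also have "\<dots> = (\<Sum>n. a n * ((\<integral>y. \<phi> n y \<partial>M) - (\<Sum>i\<in>I. w i * \<phi> n (x i)))\<^sup>2)"
    using total by (rule sums_unique)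
  finally show "((\<integral>y. f y \<partial>M) - (\<Sum>i\<in>I. w i * f (x i)))\<^sup>2 \<le>
      (\<Sum>n. a n * ((\<integral>y. \<phi> n y \<partial>M) - (\<Sum>i\<in>I. w i * \<phi> n (x i)))\<^sup>2)" .
qed

section \<open>Mercer expansion of the Gaussian kernel\<close>

lemma mercer_eps_square: "0 < l \<Longrightarrow> (mercer_eps l)\<^sup>2 = 1 / (2 * l\<^sup>2)"
  by (simp add: mercer_eps_def power_divide power_mult_distrib)

lemma mercer_beta_gt_1:
  assumes "0 < l"
  shows "1 < mercer_beta l"
  unfolding mercer_beta_def
  by (rule gr_one_powr) (use assms in \<open>auto simp: mercer_alpha_def mercer_eps_def\<close>)

text \<open>Solves \<beta>^4 = 1 + 8 \<epsilon>^2 for \<epsilon>^2. With b = \<beta>^2, the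
  quantities \<epsilon>^2, \<delta>^2, \<tau> and \<lambda> all become rational in b, so the later
  identities contain no fractional powers of the length-scale.\<close>

lemma mercer_eps_square_eq_beta:
  assumes "0 < l"
  shows "(mercer_eps l)\<^sup>2 = (((mercer_beta l)\<^sup>2)\<^sup>2 - 1) / 8"
proof -
  define X where "X = 1 + (2 * mercer_eps l / mercer_alpha)\<^sup>2"
  have "0 < X" by (simp add: X_def add_pos_nonneg)
  have "((mercer_beta l)\<^sup>2)\<^sup>2 = mercer_beta l ^ 4" by (simp flip: power_mult)
  also have "\<dots> = X powr (1 / 4 * real 4)"
    unfolding mercer_beta_def X_def[symmetric] using \<open>0 < X\<close>
    by (simp only: powr_powr[symmetric]) (simp add: powr_numeral)
  also have "\<dots> = X" using \<open>0 < X\<close> by simp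
  finally show ?thesis by (simp add: X_def mercer_alpha_def power_mult_distrib power_divide)
qed

lemma mercer_delta_sq_eq: "mercer_delta_sq l = ((mercer_beta l)\<^sup>2 - 1) / 4"
  by (simp add: mercer_delta_sq_def mercer_alpha_def power_divide)

lemma mercer_denominator_eq:
  assumes "0 < l"
  shows "1 / 2 + mercer_delta_sq l + (mercer_eps l)\<^sup>2 = ((mercer_beta l)\<^sup>2 + 1)\<^sup>2 / 8"
proof -
  have "1 / 2 + (b - 1) / 4 + (b\<^sup>2 - 1) / 8 = (b + 1)\<^sup>2 / 8" for b :: real
    by (simp add: field_simps power2_eq_square)
  thus ?thesis unfolding mercer_delta_sq_eq mercer_eps_square_eq_beta[OF assms] .
qed

lemma mercer_tau_eq:
  assumes "0 < l"
  shows "mercer_tau l = 2 / ((mercer_beta l)\<^sup>2 + 1)"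
proof -
  have "(1 / 2) / (((mercer_beta l)\<^sup>2 + 1)\<^sup>2 / 8) = (2 / ((mercer_beta l)\<^sup>2 + 1))\<^sup>2"
    by (simp add: power_divide)
  thus ?thesis
    unfolding mercer_tau_def mercer_denominator_eq[OF assms] by (simp add: add_nonneg_pos)
qed

lemma mercer_lambda_eq:
  assumes "0 < l"
  shows "mercer_lambda l = ((mercer_beta l)\<^sup>2 - 1) / ((mercer_beta l)\<^sup>2 + 1)"
proof -
  define b where "b = (mercer_beta l)\<^sup>2"
  have "b + 1 \<noteq> 0" using zero_le_power2[of "mercer_beta l"] unfolding b_def by linarith
  thus ?thesis
    unfolding mercer_lambda_def mercer_denominator_eq[OF assms]
    unfolding mercer_eps_square_eq_beta[OF assms] b_def[symmetric]
    by (simp add: divide_simps) (simp add: power2_eq_square algebra_simps)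
qed

lemma mercer_beta_square_gt_1: "0 < l \<Longrightarrow> 1 < (mercer_beta l)\<^sup>2"
  using mercer_beta_gt_1 by simp

lemma mercer_lambda_bounds:
  assumes "0 < l"
  shows "0 < mercer_lambda l" "mercer_lambda l < 1"
  using mercer_beta_square_gt_1[OF assms] by (simp_all add: mercer_lambda_eq[OF assms])

lemma mercer_tau_pos: "0 < l \<Longrightarrow> 0 < mercer_tau l"
  by (simp add: mercer_tau_eq add_nonneg_pos)

text \<open>With x = 1 / \<beta>^2 one has 1 / \<lambda> = (1 + x) / (1 - x), so the squared claim
  is exp(2 x) < (1 + x) / (1 - x).\<close>

lemma mercer_rate_less_1:
  assumes "0 < l"
  shows "sqrt (mercer_lambda l) * exp (1 / (mercer_beta l)\<^sup>2) < 1"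
proof -
  define b where "b = (mercer_beta l)\<^sup>2"
  have b: "1 < b" using mercer_beta_square_gt_1[OF assms] by (simp add: b_def)
  have "2 * (1 / b) < ln ((1 + 1 / b) / (1 - 1 / b))"
    by (rule two_mult_less_ln_quotient) (use b in auto)
  also have "(1 + 1 / b) / (1 - 1 / b) = 1 / mercer_lambda l"
    using b by (simp add: mercer_lambda_eq[OF assms] b_def[symmetric] divide_simps)
  finally have "exp (2 * (1 / b)) < exp (ln (1 / mercer_lambda l))" by simp
  hence "mercer_lambda l * exp (2 * (1 / b)) < 1"
    using mercer_lambda_bounds[OF assms] by (simp add: field_simps)
  also have "mercer_lambda l * exp (2 * (1 / b)) = (sqrt (mercer_lambda l) * exp (1 / b))\<^sup>2"
    using mercer_lambda_bounds[OF assms]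
    by (simp add: power_mult_distrib flip: exp_of_nat_mult)
  finally have "(sqrt (mercer_lambda l) * exp (1 / b))\<^sup>2 < 1\<^sup>2" by simp
  thus ?thesis unfolding b_def by (rule power2_less_imp_less) simp
qed

lemma mercer_phi_eq:
  "mercer_phi l n x = sqrt (mercer_beta l / fact n) * exp (- ((mercer_beta l)\<^sup>2 - 1) / 4 * x\<^sup>2)
     * hermite_prob n (mercer_beta l * x)"
proof -
  have "sqrt 2 * mercer_alpha * mercer_beta l * x = mercer_beta l * x"
    by (simp add: mercer_alpha_def)
  moreover have "- mercer_delta_sq l * x\<^sup>2 = - ((mercer_beta l)\<^sup>2 - 1) / 4 * x\<^sup>2"
    by (simp add: mercer_delta_sq_eq field_simps)
  ultimately show ?thesis unfolding mercer_phi_def by (simp only:)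
qed

text \<open>Mehler's formula at t = \<lambda> with arguments \<beta> x and \<beta> y. The Gaussian
  factors of the eigenfunctions complete its exponent to - \<epsilon>^2 (x - y)^2, and the
  prefactors cancel: \<tau> \<beta> (1 - \<lambda>^2)^(-1/2) = 1.\<close>

lemma mercer_expansion:
  assumes l: "0 < l"
  shows "(\<lambda>n. mercer_tau l * mercer_lambda l ^ n * mercer_phi l n x * mercer_phi l n y) sums gauss_kernel l x y"
proof -
  define \<beta> where "\<beta> = mercer_beta l"
  define b where "b = \<beta>\<^sup>2"
  define t where "t = mercer_lambda l"
  have \<beta>: "1 < \<beta>" unfolding \<beta>_def by (rule mercer_beta_gt_1[OF l])
  have b: "1 < b" unfolding b_def \<beta>_def by (rule mercer_beta_square_gt_1[OF l])
  have t: "\<bar>t\<bar> < 1" using mercer_lambda_bounds[OF l] by (simp add: t_def)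
  have t_eq: "t = (b - 1) / (b + 1)" by (simp add: t_def mercer_lambda_eq[OF l] b_def \<beta>_def)
  have tau_eq: "mercer_tau l = 2 / (b + 1)" by (simp add: mercer_tau_eq[OF l] b_def \<beta>_def)
  have t2: "1 - t\<^sup>2 = 4 * b / (b + 1)\<^sup>2"
    unfolding t_eq power_divide using b by (simp add: divide_simps) (simp add: power2_eq_square algebra_simps)
  define e where "e = exp (- (b - 1) / 4 * x\<^sup>2) * exp (- (b - 1) / 4 * y\<^sup>2)"
  define C where "C = mercer_tau l * \<beta> * e"
  define E where "E = (2 * t * (\<beta> * x) * (\<beta> * y) - t\<^sup>2 * ((\<beta> * x)\<^sup>2 + (\<beta> * y)\<^sup>2)) / (2 * (1 - t\<^sup>2))"
  have exponent: "- (b - 1) / 4 * x\<^sup>2 + - (b - 1) / 4 * y\<^sup>2 + E = - (x - y)\<^sup>2 * ((b\<^sup>2 - 1) / 8)"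
  proof -
    have "E = ((b + 1) * t * b * (x * y) * (b + 1) - ((b + 1) * t)\<^sup>2 * b * (x\<^sup>2 + y\<^sup>2) / 2) / (4 * b)"
      unfolding E_def t2 using b by (simp add: b_def[symmetric] power_mult_distrib divide_simps)
        (simp add: b_def algebra_simps power2_eq_square)
    also have "(b + 1) * t = b - 1" using b by (simp add: t_eq)
    also have "((b - 1) * b * (x * y) * (b + 1) - (b - 1)\<^sup>2 * b * (x\<^sup>2 + y\<^sup>2) / 2) / (4 * b) =
        ((b - 1) * (x * y) * (b + 1) - (b - 1)\<^sup>2 * (x\<^sup>2 + y\<^sup>2) / 2) / 4"
      using b by (simp add: field_simps)
    finally show ?thesis by (simp add: field_simps power2_eq_square)
  qed
  have "(\<lambda>n. C * (t ^ n * (hermite_prob n (\<beta> * x) * hermite_prob n (\<beta> * y) / fact n))) sums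
      (C * ((1 - t\<^sup>2) powr (-1/2) * exp E))"
    unfolding E_def by (intro sums_mult mehler_sums t)
  moreover have "C * (t ^ n * (hermite_prob n (\<beta> * x) * hermite_prob n (\<beta> * y) / fact n)) =
      mercer_tau l * mercer_lambda l ^ n * mercer_phi l n x * mercer_phi l n y" for n
  proof -
    have "mercer_phi l n x * mercer_phi l n y = (sqrt (\<beta> / fact n) * sqrt (\<beta> / fact n)) * e *
        (hermite_prob n (\<beta> * x) * hermite_prob n (\<beta> * y))"
      unfolding mercer_phi_eq \<beta>_def[symmetric] b_def[symmetric] e_def by (simp only: mult_ac)
    also have "sqrt (\<beta> / fact n) * sqrt (\<beta> / fact n) = \<beta> / fact n" using \<beta> by simp
    finally show ?thesis by (simp add: C_def t_def mult.assoc)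
  qed
  moreover have "C * ((1 - t\<^sup>2) powr (-1/2) * exp E) = gauss_kernel l x y"
  proof -
    have "(1 - t\<^sup>2) powr (-1/2) = 1 / sqrt (1 - t\<^sup>2)"
      using t by (simp add: powr_minus powr_half_sqrt abs_square_le_1 inverse_eq_divide)
    also have "sqrt (1 - t\<^sup>2) = 2 * \<beta> / (b + 1)"
      unfolding t2 using \<beta> b by (simp add: real_sqrt_divide real_sqrt_mult b_def)
    finally have one: "mercer_tau l * \<beta> * (1 - t\<^sup>2) powr (-1/2) = 1"
      using \<beta> b by (simp add: tau_eq)
    have "C * ((1 - t\<^sup>2) powr (-1/2) * exp E) =
        (mercer_tau l * \<beta> * (1 - t\<^sup>2) powr (-1/2)) * (e * exp E)"
      by (simp only: C_def mult_ac)
    also have "\<dots> = e * exp E" by (simp only: one mult_1_left)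
    also have "\<dots> = exp (- (b - 1) / 4 * x\<^sup>2 + - (b - 1) / 4 * y\<^sup>2 + E)"
      by (simp only: e_def exp_add)
    also note exponent
    also have "(b\<^sup>2 - 1) / 8 = 1 / (2 * l\<^sup>2)"
      using mercer_eps_square_eq_beta[OF l] mercer_eps_square[OF l] by (simp add: b_def \<beta>_def)
    finally show ?thesis by (simp add: gauss_kernel_def)
  qed
  ultimately show ?thesis by simp
qed

section \<open>Size of the eigenfunctions\<close>

lemma borel_measurable_mercer_phi [measurable]: "mercer_phi l n \<in> borel_measurable borel"
  unfolding mercer_phi_eq[abs_def] by measurable

lemma mercer_phi_square:
  assumes l: "0 < l"
  shows "integrable gaussian (\<lambda>x. (mercer_phi l n x)\<^sup>2)" and "(\<integral>x. (mercer_phi l n x)\<^sup>2 \<partial>gaussian) = 1"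
proof -
  have "0 < mercer_beta l" using mercer_beta_gt_1[OF l] by simp
  hence eq: "(mercer_phi l n x)\<^sup>2 = mercer_beta l / fact n * exp (- ((mercer_beta l)\<^sup>2 - 1) / 2 * x\<^sup>2)
      * (hermite_prob n (mercer_beta l * x))\<^sup>2" for x
    unfolding mercer_phi_eq by (simp add: power_mult_distrib flip: exp_of_nat_mult)
  show "integrable gaussian (\<lambda>x. (mercer_phi l n x)\<^sup>2)" and "(\<integral>x. (mercer_phi l n x)\<^sup>2 \<partial>gaussian) = 1"
    unfolding eq by (rule gaussian_rescaled_hermite_square[OF \<open>0 < mercer_beta l\<close>])+
qed

lemma mercer_phi_integrable:
  assumes l: "0 < l"
  shows "integrable gaussian (mercer_phi l n)" and "(\<integral>x. \<bar>mercer_phi l n x\<bar> \<partial>gaussian) \<le> 1"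
proof -
  note sq = mercer_phi_square[OF l, of n]
  have le: "\<bar>u\<bar> \<le> (1 + u\<^sup>2) / 2" for u :: real
    using zero_le_power2[of "\<bar>u\<bar> - 1"] by (simp add: power2_diff)
  have int: "integrable gaussian (\<lambda>x. (1 + (mercer_phi l n x)\<^sup>2) / 2)"
    using sq(1) by simp
  show int_phi: "integrable gaussian (mercer_phi l n)"
    by (rule Bochner_Integration.integrable_bound[OF int]) (use le in auto)
  have "(\<integral>x. \<bar>mercer_phi l n x\<bar> \<partial>gaussian) \<le> (\<integral>x. (1 + (mercer_phi l n x)\<^sup>2) / 2 \<partial>gaussian)"
    using int_phi int le by (intro integral_mono) auto
  also have "\<dots> = 1"
    using sq gaussian.prob_space by simp
  finally show "(\<integral>x. \<bar>mercer_phi l n x\<bar> \<partial>gaussian) \<le> 1" .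
qed

text \<open>The exponent carries M rather than n: the radius of the nodes is fixed by M, while
  raising n above M only widens the region where Cramer's bound applies.\<close>

lemma mercer_phi_bound:
  assumes l: "0 < l" and M: "1 \<le> M" "M \<le> n" and x: "\<bar>x\<bar> \<le> 2 * sqrt (real M) / mercer_beta l"
  shows "\<bar>mercer_phi l n x\<bar> \<le> 1087 / 1000 * sqrt (mercer_beta l) * exp (real M / (mercer_beta l)\<^sup>2)"
proof -
  define \<beta> where "\<beta> = mercer_beta l"
  have \<beta>: "0 < \<beta>" using mercer_beta_gt_1[OF l] by (simp add: \<beta>_def)
  have "\<bar>x\<bar>\<^sup>2 \<le> (2 * sqrt (real M) / \<beta>)\<^sup>2"
    using x by (intro power_mono) (auto simp: \<beta>_def)
  hence x2: "x\<^sup>2 \<le> 4 * real M / \<beta>\<^sup>2" by (simp add: power_divide power_mult_distrib)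
  have "(\<beta> * x)\<^sup>2 \<le> 4 * real M" using x2 \<beta> by (simp add: power_mult_distrib field_simps)
  also have "\<dots> \<le> 4 * real n" using M by simp
  finally have cramer: "\<bar>hermite_prob n (\<beta> * x)\<bar> * exp (- (\<beta> * x)\<^sup>2 / 4) \<le> 1087 / 1000 * sqrt (fact n)"
    using M by (intro cramer_bound_oscillatory) auto
  have "exp (- (\<beta>\<^sup>2 - 1) / 4 * x\<^sup>2) = exp (- (\<beta> * x)\<^sup>2 / 4) * exp (x\<^sup>2 / 4)"
    unfolding exp_add[symmetric] by (simp add: field_simps power2_eq_square)
  hence "\<bar>mercer_phi l n x\<bar> = sqrt (\<beta> / fact n) * exp (x\<^sup>2 / 4) *
      (\<bar>hermite_prob n (\<beta> * x)\<bar> * exp (- (\<beta> * x)\<^sup>2 / 4))"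
    using \<beta> unfolding mercer_phi_eq \<beta>_def[symmetric] by (simp add: abs_mult mult_ac)
  also have "\<dots> \<le> sqrt (\<beta> / fact n) * exp (real M / \<beta>\<^sup>2) * (1087 / 1000 * sqrt (fact n))"
  proof (rule mult_mono[OF mult_left_mono cramer])
    show "exp (x\<^sup>2 / 4) \<le> exp (real M / \<beta>\<^sup>2)" using x2 by (simp add: mult.commute)
  qed (use \<beta> in auto)
  also have "\<dots> = 1087 / 1000 * sqrt \<beta> * exp (real M / \<beta>\<^sup>2)"
    by (simp add: real_sqrt_divide)
  finally show ?thesis by (simp only: \<beta>_def)
qed

section \<open>The error bound\<close>

text \<open>Reproduction bounds |f y - f x| by the norm of f times the norm of the difference of two
  kernel sections, whose square is 2 - 2 k(y, x) and tends to zero as y approaches x. So f is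
  continuous, hence measurable, and k(x, x) = 1 makes it bounded.\<close>

lemma gauss_rkhs_integrable:
  assumes "rkhs (gauss_kernel l) H ip" and f: "f \<in> H"
  shows "integrable gaussian f"
proof -
  interpret rkhs "gauss_kernel l" H ip by fact
  define C where "C = ip f f"
  have k_diag: "gauss_kernel l x x = 1" for x by (simp add: gauss_kernel_def)
  have k_comm: "gauss_kernel l x y = gauss_kernel l y x" for x y
    by (simp add: gauss_kernel_def power2_commute)
  \<comment> \<open>The general inequality comes from \<open>ip_square_le\<close> by normalising f,
    which is why a vanishing norm is treated apart.\<close>
  have cs: "(ip f v)\<^sup>2 \<le> C * ip v v" if v: "v \<in> H" for v
  proof (cases "C = 0")
    case True
    hence "f = (\<lambda>x. 0)" using f by (simp add: C_def ip_definite)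
    hence "ip f v = 0" using ip_scale_left[OF zero_mem v, of 0] by simp
    thus ?thesis using True by simp
  next
    case False
    hence C: "0 < C" using ip_nonneg[OF f] by (simp add: C_def)
    let ?g = "\<lambda>x. (1 / sqrt C) * f x"
    have g: "?g \<in> H" by (rule scale_mem[OF f])
    have "ip ?g ?g = (1 / sqrt C) * ((1 / sqrt C) * C)"
      by (simp only: ip_scale_left[OF f g] ip_commute[OF f g] ip_scale_left[OF f f] C_def[symmetric])
    also have "\<dots> = 1" using C by simp
    finally have "(ip ?g v)\<^sup>2 \<le> ip v v" by (intro ip_square_le[OF g v]) simp
    thus ?thesis
      using C unfolding ip_scale_left[OF f v] by (simp add: power_mult_distrib power_divide field_simps)
  qed
  have bound: "norm (f x) \<le> sqrt C" for x
  proof -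
    have "(f x)\<^sup>2 \<le> C * 1"
      using cs[OF kernel_mem[of x]] by (simp add: reproducing[OF f] reproducing[OF kernel_mem] k_diag)
    thus ?thesis by (simp add: real_le_rsqrt)
  qed
  have diff: "\<bar>f y - f x\<bar> \<le> sqrt (C * (2 - 2 * gauss_kernel l y x))" for x y
  proof -
    let ?v = "\<lambda>z. gauss_kernel l z y + (-1) * gauss_kernel l z x"
    have m: "(\<lambda>z. (-1) * gauss_kernel l z x) \<in> H" by (rule scale_mem[OF kernel_mem])
    have v: "?v \<in> H" by (rule add_mem[OF kernel_mem m])
    have ip_v: "ip ?v h = h y - h x" if h: "h \<in> H" for h
      using ip_add_left[OF kernel_mem m h] ip_scale_left[OF kernel_mem h, of "-1" x]
        ip_commute[OF kernel_mem h] reproducing[OF h] by simp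
    have "(f y - f x)\<^sup>2 = (ip f ?v)\<^sup>2" using ip_v[OF f] ip_commute[OF f v] by simp
    also have "\<dots> \<le> C * ip ?v ?v" by (rule cs[OF v])
    also have "ip ?v ?v = 2 - 2 * gauss_kernel l y x"
      unfolding ip_v[OF v] by (simp add: k_diag k_comm[of x y])
    finally show ?thesis by (intro real_le_rsqrt) simp
  qed
  have "isCont f x" for x
  proof -
    have "((\<lambda>y. sqrt (C * (2 - 2 * gauss_kernel l y x))) \<longlongrightarrow> sqrt (C * (2 - 2 * gauss_kernel l x x))) (at x)"
      unfolding gauss_kernel_def divide_inverse by (intro tendsto_intros)
    hence "((\<lambda>y. sqrt (C * (2 - 2 * gauss_kernel l y x))) \<longlongrightarrow> 0) (at x)" by (simp add: k_diag)
    hence "((\<lambda>y. f y - f x) \<longlongrightarrow> 0) (at x)"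
      by (rule Lim_null_comparison[rotated]) (use diff in simp)
    thus ?thesis unfolding isCont_def by (simp add: LIM_zero_iff)
  qed
  hence [measurable]: "f \<in> borel_measurable borel"
    by (intro borel_measurable_continuous_onI continuous_at_imp_continuous_on) auto
  show ?thesis
    by (rule gaussian.integrable_const_bound[of _ "sqrt C"]) (use bound in auto)
qed

lemma quadrature_error_bound:
  assumes H: "rkhs (gauss_kernel l) H ip" and l: "0 < l"
    and W: "(\<Sum>n=1..N. \<bar>w n\<bar>) \<le> W" and M: "1 \<le> M"
    and exact: "\<And>n. n < M \<Longrightarrow> quadrature N w x (mercer_phi l n) = gauss_mean (mercer_phi l n)"
    and nodes: "\<And>i. i \<in> {1..N} \<Longrightarrow> \<bar>x i\<bar> \<le> 2 * sqrt (real M) / mercer_beta l"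
    and f: "f \<in> H" "rkhs_norm ip f \<le> 1"
  shows "\<bar>gauss_mean f - quadrature N w x f\<bar> \<le>
    (1 + 1087 / 1000 * sqrt (mercer_beta l) * W) * (sqrt (mercer_tau l) / (1 - sqrt (mercer_lambda l))) *
    (sqrt (mercer_lambda l) * exp (1 / (mercer_beta l)\<^sup>2)) ^ M"
proof -
  interpret rkhs "gauss_kernel l" H ip by fact
  define t where "t = mercer_lambda l"
  define \<tau> where "\<tau> = mercer_tau l"
  define a where "a = (\<lambda>n. \<tau> * t ^ n)"
  define K where "K = 1087 / 1000 * sqrt (mercer_beta l)"
  define E where "E = exp (real M / (mercer_beta l)\<^sup>2)"
  \<comment> \<open>Since E \<ge> 1, the contribution 1 of \<mu> may be multiplied by E as well. The
    whole factor E = exp(1 / \<beta>^2)^M then joins sqrt \<lambda>^M to form \<eta>^M.\<close>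
  define T where "T = (1 + K * W) * E"
  define L where "L = (\<lambda>n. (\<integral>y. mercer_phi l n y \<partial>gaussian) - (\<Sum>i\<in>{1..N}. w i * mercer_phi l n (x i)))"
  have t: "0 < t" "t < 1" unfolding t_def by (rule mercer_lambda_bounds[OF l])+
  have \<tau>: "0 < \<tau>" unfolding \<tau>_def by (rule mercer_tau_pos[OF l])
  have K: "0 \<le> K" using mercer_beta_gt_1[OF l] by (simp add: K_def)
  have W0: "0 \<le> W" by (rule order.trans[OF sum_nonneg W]) simp
  have E: "1 \<le> E" by (simp add: E_def)
  have T: "0 \<le> T" using K W0 E by (simp add: T_def)
  have a0: "0 \<le> a n" for n using t \<tau> by (simp add: a_def)
  have "summable (\<lambda>n. sqrt \<tau> * sqrt t ^ n)"
    using t by (intro summable_mult summable_geometric) (simp add: real_sqrt_lt_1_iff)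
  hence sqrt_a: "summable (\<lambda>n. sqrt (a n))" by (simp add: a_def real_sqrt_mult real_sqrt_power)
  have ip_f: "ip f f \<le> 1" using f(2) ip_nonneg[OF f(1)] by (simp add: rkhs_norm_def)
  note hyps = gaussian.prob_space_axioms gauss_rkhs_integrable[OF H] a0 sqrt_a
  have expansion: "(\<lambda>n. a n * mercer_phi l n p * mercer_phi l n q) sums gauss_kernel l p q" for p q
    unfolding a_def \<tau>_def t_def by (rule mercer_expansion[OF l])
  have diag: "gauss_kernel l p p = 1" for p by (simp add: gauss_kernel_def)
  note mercer = quadrature_error_mercer[OF hyps expansion diag mercer_phi_integrable[OF l] f(1) ip_f
      finite_atLeastAtMost]
  have summable: "summable (\<lambda>n. a n * (L n)\<^sup>2)" unfolding L_def by (rule mercer)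
  have "((\<integral>y. f y \<partial>gaussian) - (\<Sum>i=1..N. w i * f (x i)))\<^sup>2 \<le> (\<Sum>n. a n * (L n)\<^sup>2)"
    unfolding L_def by (rule mercer)
  also have "\<dots> \<le> (\<Sum>n. T\<^sup>2 * \<tau> * t ^ M * t ^ n)"
  proof -
    have "L n = 0" if "n < M" for n
      using exact[OF that] by (simp add: L_def quadrature_def gauss_mean_def)
    hence "(\<Sum>n. a n * (L n)\<^sup>2) = (\<Sum>n. a (n + M) * (L (n + M))\<^sup>2)"
      using suminf_split_initial_segment[OF summable, of M] by simp
    also have "\<dots> \<le> (\<Sum>n. T\<^sup>2 * \<tau> * t ^ M * t ^ n)"
    proof (rule suminf_le)
      fix n
      have "\<bar>\<integral>y. mercer_phi l (n + M) y \<partial>gaussian\<bar> \<le> 1"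
        by (rule order.trans[OF integral_abs_bound mercer_phi_integrable(2)[OF l]])
      moreover have "\<bar>\<Sum>i\<in>{1..N}. w i * mercer_phi l (n + M) (x i)\<bar> \<le> W * (K * E)"
      proof -
        have "\<bar>\<Sum>i\<in>{1..N}. w i * mercer_phi l (n + M) (x i)\<bar> \<le>
            (\<Sum>i\<in>{1..N}. \<bar>w i * mercer_phi l (n + M) (x i)\<bar>)" by (rule sum_abs)
        also have "\<dots> \<le> (\<Sum>i\<in>{1..N}. \<bar>w i\<bar> * (K * E))"
        proof (rule sum_mono)
          fix i assume "i \<in> {1..N}"
          hence "\<bar>mercer_phi l (n + M) (x i)\<bar> \<le> K * E"
            unfolding K_def E_def using M nodes by (intro mercer_phi_bound[OF l]) auto
          thus "\<bar>w i * mercer_phi l (n + M) (x i)\<bar> \<le> \<bar>w i\<bar> * (K * E)"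
            unfolding abs_mult by (rule mult_left_mono) simp
        qed
        also have "\<dots> = (\<Sum>i\<in>{1..N}. \<bar>w i\<bar>) * (K * E)" by (rule sum_distrib_right[symmetric])
        also have "\<dots> \<le> W * (K * E)" by (rule mult_right_mono[OF W]) (use K E in auto)
        finally show ?thesis .
      qed
      ultimately have "\<bar>L (n + M)\<bar> \<le> 1 + W * (K * E)" unfolding L_def by linarith
      also have "\<dots> \<le> T" using E by (simp add: T_def algebra_simps)
      finally have "(L (n + M))\<^sup>2 \<le> T\<^sup>2" by (metis abs_ge_zero power2_abs power_mono)
      hence "a (n + M) * (L (n + M))\<^sup>2 \<le> a (n + M) * T\<^sup>2" by (rule mult_left_mono) (rule a0)
      thus "a (n + M) * (L (n + M))\<^sup>2 \<le> T\<^sup>2 * \<tau> * t ^ M * t ^ n"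
        by (simp add: a_def power_add mult_ac)
    next
      show "summable (\<lambda>n. a (n + M) * (L (n + M))\<^sup>2)"
        using summable by (rule summable_ignore_initial_segment)
      show "summable (\<lambda>n. T\<^sup>2 * \<tau> * t ^ M * t ^ n)"
        using t by (intro summable_mult summable_geometric) simp
    qed
    finally show ?thesis .
  qed
  also have "\<dots> = T\<^sup>2 * \<tau> * t ^ M * (1 / (1 - t))"
    using t by (simp add: suminf_mult suminf_geometric summable_geometric)
  \<comment> \<open>After taking roots the sum of squares would give 1 / sqrt (1 - \<lambda>), which
    is at most the factor 1 / (1 - sqrt \<lambda>) in the stated constant.\<close>
  also have "\<dots> \<le> T\<^sup>2 * \<tau> * t ^ M * (1 / (1 - sqrt t)\<^sup>2)"
  proof -
    have s: "0 < sqrt t" "sqrt t < 1" using t by auto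
    have "(1 - sqrt t)\<^sup>2 = (1 - sqrt t) * (1 - sqrt t)" by (rule power2_eq_square)
    also have "\<dots> \<le> (1 - sqrt t) * (1 + sqrt t)" using s by (intro mult_left_mono) auto
    also have "\<dots> = 1 - t" using t by (simp add: algebra_simps)
    finally have "1 / (1 - t) \<le> 1 / (1 - sqrt t)\<^sup>2" using s t by (intro divide_left_mono mult_pos_pos) auto
    thus ?thesis by (rule mult_left_mono) (use \<tau> t in auto)
  qed
  also have "\<dots> = (T * (sqrt \<tau> / (1 - sqrt t)) * sqrt t ^ M)\<^sup>2"
  proof -
    have "(sqrt t ^ M)\<^sup>2 = t ^ M"
      using t by (metis less_imp_le mult.commute power_mult real_sqrt_pow2)
    thus ?thesis using \<tau> by (simp add: power_mult_distrib power_divide)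
  qed
  finally have "\<bar>(\<integral>y. f y \<partial>gaussian) - (\<Sum>i=1..N. w i * f (x i))\<bar> \<le>
      \<bar>T * (sqrt \<tau> / (1 - sqrt t)) * sqrt t ^ M\<bar>"
    unfolding abs_le_square_iff .
  also have "\<dots> = T * (sqrt \<tau> / (1 - sqrt t)) * sqrt t ^ M"
    using T \<tau> t by simp
  also have "\<dots> = (1 + K * W) * (sqrt \<tau> / (1 - sqrt t)) * (sqrt t * exp (1 / (mercer_beta l)\<^sup>2)) ^ M"
  proof -
    have "exp (1 / (mercer_beta l)\<^sup>2) ^ M = E"
      unfolding E_def exp_of_nat_mult[symmetric] by simp
    thus ?thesis by (simp add: T_def power_mult_distrib)
  qed
  finally show ?thesis
    by (simp only: gauss_mean_def quadrature_def K_def t_def \<tau>_def)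
qed

text \<open>\<open>K\<close> is quantified before \<open>l\<close>, which makes it an absolute
  constant.\<close>

theorem theorem3p1:
  shows "\<exists>K::real. 0 < K \<and> K \<le> 1.087 \<and>
    (\<forall>l::real. 0 < l \<longrightarrow>
      (\<exists>C1 C2 \<eta> :: real.
        C1 = K * sqrt (mercer_beta l) \<and>
        C2 = sqrt (mercer_tau l) / (1 - sqrt (mercer_lambda l)) \<and>
        \<eta> = sqrt (mercer_lambda l) * exp (1 / (mercer_beta l)\<^sup>2) \<and>
        0 < C1 \<and> 0 < C2 \<and> 0 < \<eta> \<and> \<eta> < 1 \<and>
        (\<forall>H ip. rkhs (gauss_kernel l) H ip \<longrightarrow>
          (\<forall>(N::nat) (x :: nat \<Rightarrow> real) (w :: nat \<Rightarrow> real) (W::real) (M::nat).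
            1 \<le> N \<longrightarrow>
            0 \<le> W \<longrightarrow>
            (\<Sum>n=1..N. \<bar>w n\<bar>) \<le> W \<longrightarrow>
            1 \<le> M \<longrightarrow>
            (\<forall>n<M. quadrature N w x (mercer_phi l n) = gauss_mean (mercer_phi l n)) \<longrightarrow>
            (SUP n\<in>{1..N}. \<bar>x n\<bar>) \<le> 2 * sqrt (real M) / mercer_beta l \<longrightarrow>
            worst_case_error H ip (quadrature N w x) \<le> ereal ((1 + C1 * W) * C2 * \<eta> ^ M)))))"
proof (rule exI[of _ "1087 / 1000"], intro conjI allI impI)
  fix l :: real
  assume l: "0 < l"
  define C1 where "C1 = 1087 / 1000 * sqrt (mercer_beta l)"
  define C2 where "C2 = sqrt (mercer_tau l) / (1 - sqrt (mercer_lambda l))"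
  define \<eta> where "\<eta> = sqrt (mercer_lambda l) * exp (1 / (mercer_beta l)\<^sup>2)"
  have "0 < C1" using mercer_beta_gt_1[OF l] by (simp add: C1_def)
  moreover have "0 < C2" using mercer_tau_pos[OF l] mercer_lambda_bounds[OF l] by (simp add: C2_def)
  moreover have "0 < \<eta>" using mercer_lambda_bounds[OF l] by (simp add: \<eta>_def)
  moreover have "\<eta> < 1" unfolding \<eta>_def by (rule mercer_rate_less_1[OF l])
  moreover have "worst_case_error H ip (quadrature N w x) \<le> ereal ((1 + C1 * W) * C2 * \<eta> ^ M)"
    if H: "rkhs (gauss_kernel l) H ip" and W: "(\<Sum>n=1..N. \<bar>w n\<bar>) \<le> W" and M: "1 \<le> M"
      and exact: "\<forall>n<M. quadrature N w x (mercer_phi l n) = gauss_mean (mercer_phi l n)"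
      and nodes: "(SUP n\<in>{1..N}. \<bar>x n\<bar>) \<le> 2 * sqrt (real M) / mercer_beta l"
    for H ip N x w W M
    unfolding worst_case_error_def
  proof (rule SUP_least)
    fix f assume "f \<in> {f \<in> H. rkhs_norm ip f \<le> 1}"
    hence f: "f \<in> H" "rkhs_norm ip f \<le> 1" by auto
    \<comment> \<open>A supremum in the reals bounds its members only when the family is bounded
      above, which holds here because the index set is finite.\<close>
    have "\<bar>x i\<bar> \<le> 2 * sqrt (real M) / mercer_beta l" if "i \<in> {1..N}" for i
      by (rule order.trans[OF cSUP_upper[OF that] nodes]) simp
    thus "ereal \<bar>gauss_mean f - quadrature N w x f\<bar> \<le> ereal ((1 + C1 * W) * C2 * \<eta> ^ M)"
      using quadrature_error_bound[OF H l W M _ _ f] exact by (simp add: C1_def C2_def \<eta>_def)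
  qed
  ultimately show "\<exists>C1 C2 \<eta> :: real.
        C1 = 1087 / 1000 * sqrt (mercer_beta l) \<and>
        C2 = sqrt (mercer_tau l) / (1 - sqrt (mercer_lambda l)) \<and>
        \<eta> = sqrt (mercer_lambda l) * exp (1 / (mercer_beta l)\<^sup>2) \<and>
        0 < C1 \<and> 0 < C2 \<and> 0 < \<eta> \<and> \<eta> < 1 \<and>
        (\<forall>H ip. rkhs (gauss_kernel l) H ip \<longrightarrow>
          (\<forall>(N::nat) (x :: nat \<Rightarrow> real) (w :: nat \<Rightarrow> real) (W::real) (M::nat).
            1 \<le> N \<longrightarrow>
            0 \<le> W \<longrightarrow>
            (\<Sum>n=1..N. \<bar>w n\<bar>) \<le> W \<longrightarrow>
            1 \<le> M \<longrightarrow>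
            (\<forall>n<M. quadrature N w x (mercer_phi l n) = gauss_mean (mercer_phi l n)) \<longrightarrow>
            (SUP n\<in>{1..N}. \<bar>x n\<bar>) \<le> 2 * sqrt (real M) / mercer_beta l \<longrightarrow>
            worst_case_error H ip (quadrature N w x) \<le> ereal ((1 + C1 * W) * C2 * \<eta> ^ M)))"
    by (intro exI[of _ C1] exI[of _ C2] exI[of _ \<eta>] conjI allI impI) (simp_all only: C1_def C2_def \<eta>_def)
qed simp_all

end
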